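(* Let $k$ be a commutative ring. Under the duality biequivalence ${}_{\mathcal C(\mathcal M_k^{\mathrm f})}\mathrm{Cat}\to{}^{\mathcal A(\mathcal M_k^{\mathrm f})}\mathrm{Cat}$, which sends a $\mathcal C(\mathcal M_k^{\mathrm f})$-category $A$ to the dual $\mathcal A(\mathcal M_k^{\mathrm f})$-category $C$ with $C_{x,y}=A_{y,x}^*$, Hopf $\mathcal M_k^{\mathrm f}$-categories correspond to dual Hopf $\mathcal M_k^{\mathrm f}$-categories. That is, if $A$ and $C$ correspond to each other, then $A$ is a Hopf $\mathcal M_k^{\mathrm f}$-category if and only if $C$ is a dual Hopf $\mathcal M_k^{\mathrm f}$-category.
   Context: $\mathcal M_k^{\mathrm f}$ is the monoidal category of finitely generated projective $k$-modules, $\otimes=\otimes_k$, $(-)^*=\mathrm{Hom}_k(-,k)$; $\mathcal C(\mathcal M_k^{\mathrm f})$ and $\mathcal A(\mathcal M_k^{\mathrm f})$ are the monoidal categories of coalgebras and of algebras in it. A $\mathcal C(\mathcal M_k^{\mathrm f})$-category $A$ with underlying class $X$: coalgebras $A_{x,y}$ in $\mathcal M_k^{\mathrm f}$ (with $\Delta(a)=a_{(1)}\otimes a_{(2)}$ and counit $\varepsilon_{x,y}$) and coalgebra morphisms $A_{x,y}\otimes A_{y,z}\to A_{x,z}$, $a\otimes b\mapsto ab$, and $k\to A_{x,x}$, $1\mapsto 1_x$, making $A$ a $k$-linear category. It is a Hopf $\mathcal M_k^{\mathrm f}$-category if there are $k$-linear maps $S_{x,y}:A_{x,y}\to A_{y,x}$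 with $a_{(1)}S_{x,y}(a_{(2)})=\varepsilon_{x,y}(a)1_x$ and $S_{x,y}(a_{(1)})a_{(2)}=\varepsilon_{x,y}(a)1_y$ for all $x,y\in X$, $a\in A_{x,y}$. A dual $\mathcal A(\mathcal M_k^{\mathrm f})$-category $C$ with underlying class $X$: algebras $C_{x,y}$ in $\mathcal M_k^{\mathrm f}$ (multiplication $m_{x,y}$, unit map $\eta_{x,y}$) and algebra morphisms $\Delta_{x,y,z}:C_{x,z}\to C_{x,y}\otimes C_{y,z}$, $\Delta_{x,y,z}(c)=c_{(1,y)}\otimes c_{(2,y)}$, and $\varepsilon_x:C_{x,x}\to k$ with $(\Delta_{x,y,z}\otimes\mathrm{id})\circ\Delta_{x,z,u}=(\mathrm{id}\otimes\Delta_{y,z,u})\circ\Delta_{x,y,u}$ and $(\varepsilon_x\otimes\mathrm{id})\circ\Delta_{x,x,y}=\mathrm{id}=(\mathrm{id}\otimes\varepsilon_y)\circ\Delta_{x,y,y}$. It is a dual Hopf $\mathcal M_k^{\mathrm f}$-category if there are $k$-linear maps $S_{x,y}:C_{y,x}\to C_{x,y}$ such that, for all $x,y\in X$, $m_{x,y}\circ(\mathrm{id}\otimes S_{x,y})\circ\Delta_{x,y,x}=\eta_{x,y}\circ\varepsilon_x$ and $m_{y,x}\circ(S_{y,x}\otimes\mathrm{id})\circ\Delta_{x,y,x}=\eta_{y,x}\circ\varepsilon_x$. The correspondence on objects: given $A$, put $C_{x,y}=A_{y,x}^*$. The maps $\Delta_{z,y,x}:C_{z,x}\to C_{z,y}\otimes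 C_{y,x}$ are determined by $\langle c,ab\rangle=\langle c_{(2,y)},a\rangle\langle c_{(1,y)},b\rangle$ for $a\in A_{x,y}$, $b\in A_{y,z}$, $c\in C_{z,x}=A_{x,z}^*$; the counits are $\varepsilon_x(c)=\langle c,1_x\rangle$; the multiplication on $C_{x,y}=A_{y,x}^*$ is the opposite convolution $\langle cd,a\rangle=\langle c,a_{(2)}\rangle\langle d,a_{(1)}\rangle$ with unit element $\varepsilon_{y,x}$. Conversely, $A$ is recovered from $C$ (up to the canonical identification with the bidual) by $A_{x,y}=C_{y,x}^*$ with the dual structure. *)

theory Defs
  imports "HOL-Algebra.AbelCoset" "HOL-Algebra.Module"
begin

section \<open>Modules over a commutative ring\<close>

definition lin_maps ::
  "('k, 'r) ring_scheme \<Rightarrow> ('k, 'm, 's) module_scheme \<Rightarrow> ('k, 'n, 't) module_scheme \<Rightarrow> ('m \<Rightarrow> 'n) set"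
  where "lin_maps k M N = {f \<in> carrier M \<rightarrow> carrier N.
     (\<forall>x\<in>carrier M. \<forall>y\<in>carrier M. f (x \<oplus>\<^bsub>M\<^esub> y) = f x \<oplus>\<^bsub>N\<^esub> f y) \<and>
     (\<forall>r\<in>carrier k. \<forall>x\<in>carrier M. f (r \<odot>\<^bsub>M\<^esub> x) = r \<odot>\<^bsub>N\<^esub> f x)}"

definition regular_module :: "('k, 'r) ring_scheme \<Rightarrow> ('k, 'k) module"
  where "regular_module k = \<lparr>carrier = carrier k, mult = mult k, one = one k,
     zero = zero k, add = add k, smult = mult k\<rparr>"

text \<open>The free module on a set \<open>I\<close> consists of the finitely supported functions \<open>I \<rightarrow> k\<close>, extended by
  zero outside \<open>I\<close>. The record type \<open>module\<close> extends \<open>ring\<close>; for a mere module the fields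
  \<open>mult\<close> and \<open>one\<close> carry no meaning and are left unspecified.\<close>

definition free_module :: "('k, 'r) ring_scheme \<Rightarrow> 'i set \<Rightarrow> ('k, 'i \<Rightarrow> 'k) module"
  where "free_module k I = \<lparr>
     carrier = {f. (\<forall>i. f i \<in> carrier k) \<and> (\<forall>i. i \<notin> I \<longrightarrow> f i = \<zero>\<^bsub>k\<^esub>) \<and> finite {i. f i \<noteq> \<zero>\<^bsub>k\<^esub>}},
     mult = undefined, one = undefined,
     zero = (\<lambda>i. \<zero>\<^bsub>k\<^esub>),
     add = (\<lambda>f g i. f i \<oplus>\<^bsub>k\<^esub> g i),
     smult = (\<lambda>r f i. r \<otimes>\<^bsub>k\<^esub> f i)\<rparr>"

text \<open>Finitely generated projective: (isomorphic to) a direct summand of some \<open>k\<^sup>n\<close>, where a direct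
  summand is presented by its inclusion \<open>\<iota>\<close> and projection \<open>\<pi>\<close>.\<close>

definition fg_projective :: "('k, 'r) ring_scheme \<Rightarrow> ('k, 'm, 's) module_scheme \<Rightarrow> bool"
  where "fg_projective k M \<longleftrightarrow> module k M \<and>
     (\<exists>n::nat. \<exists>\<iota> \<in> lin_maps k M (free_module k {..<n}). \<exists>\<pi> \<in> lin_maps k (free_module k {..<n}) M.
        \<forall>m\<in>carrier M. \<pi> (\<iota> m) = m)"

definition quotient_module ::
  "('k, 'r) ring_scheme \<Rightarrow> ('k, 'm, 's) module_scheme \<Rightarrow> 'm set \<Rightarrow> ('k, 'm set) module"
  where "quotient_module k M H = \<lparr>
     carrier = a_rcosets\<^bsub>M\<^esub> H,
     mult = undefined, one = undefined,
     zero = H,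
     add = (\<lambda>U V. U <+>\<^bsub>M\<^esub> V),
     smult = (\<lambda>r U. \<Union>u\<in>U. H +>\<^bsub>M\<^esub> (r \<odot>\<^bsub>M\<^esub> u))\<rparr>"


section \<open>Tensor products\<close>

type_synonym ('k, 'm, 'n) tensor = "('m \<times> 'n \<Rightarrow> 'k) set"

definition free_gen :: "('k, 'r) ring_scheme \<Rightarrow> 'i \<Rightarrow> 'i \<Rightarrow> 'k"
  where "free_gen k i = (\<lambda>j. if j = i then \<one>\<^bsub>k\<^esub> else \<zero>\<^bsub>k\<^esub>)"

definition tensor_relators ::
  "('k, 'r) ring_scheme \<Rightarrow> ('k, 'm, 's) module_scheme \<Rightarrow> ('k, 'n, 't) module_scheme \<Rightarrow> ('m \<times> 'n \<Rightarrow> 'k) set"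
  where "tensor_relators k M N = (let F = free_module k (carrier M \<times> carrier N); e = free_gen k in
     {e (m \<oplus>\<^bsub>M\<^esub> m', n) \<ominus>\<^bsub>F\<^esub> (e (m, n) \<oplus>\<^bsub>F\<^esub> e (m', n)) | m m' n.
        m \<in> carrier M \<and> m' \<in> carrier M \<and> n \<in> carrier N} \<union>
     {e (m, n \<oplus>\<^bsub>N\<^esub> n') \<ominus>\<^bsub>F\<^esub> (e (m, n) \<oplus>\<^bsub>F\<^esub> e (m, n')) | m n n'.
        m \<in> carrier M \<and> n \<in> carrier N \<and> n' \<in> carrier N} \<union>
     {e (r \<odot>\<^bsub>M\<^esub> m, n) \<ominus>\<^bsub>F\<^esub> r \<odot>\<^bsub>F\<^esub> e (m, n) | r m n.
        r \<in> carrier k \<and> m \<in> carrier M \<and> n \<in> carrier N} \<union>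
     {e (m, r \<odot>\<^bsub>N\<^esub> n) \<ominus>\<^bsub>F\<^esub> r \<odot>\<^bsub>F\<^esub> e (m, n) | r m n.
        r \<in> carrier k \<and> m \<in> carrier M \<and> n \<in> carrier N})"

definition tensor_kernel ::
  "('k, 'r) ring_scheme \<Rightarrow> ('k, 'm, 's) module_scheme \<Rightarrow> ('k, 'n, 't) module_scheme \<Rightarrow> ('m \<times> 'n \<Rightarrow> 'k) set"
  where "tensor_kernel k M N =
     \<Inter> {H. submodule H k (free_module k (carrier M \<times> carrier N)) \<and> tensor_relators k M N \<subseteq> H}"

definition tensor_module ::
  "('k, 'r) ring_scheme \<Rightarrow> ('k, 'm, 's) module_scheme \<Rightarrow> ('k, 'n, 't) module_scheme \<Rightarrow>
   ('k, ('k, 'm, 'n) tensor) module"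
  where "tensor_module k M N =
     quotient_module k (free_module k (carrier M \<times> carrier N)) (tensor_kernel k M N)"

definition pure_tensor ::
  "('k, 'r) ring_scheme \<Rightarrow> ('k, 'm, 's) module_scheme \<Rightarrow> ('k, 'n, 't) module_scheme \<Rightarrow>
   'm \<Rightarrow> 'n \<Rightarrow> ('k, 'm, 'n) tensor"
  where "pure_tensor k M N m n =
     tensor_kernel k M N +>\<^bsub>free_module k (carrier M \<times> carrier N)\<^esub> free_gen k (m, n)"

text \<open>The linear map \<open>M \<otimes> N \<rightarrow> P\<close> with \<open>m \<otimes> n \<mapsto> B m n\<close>, for bilinear \<open>B\<close>. With \<open>t = m\<^sub>1 \<otimes> m\<^sub>2\<close> in Sweedler
  notation, \<open>tensor_lift k M N P B t\<close> is \<open>B m\<^sub>1 m\<^sub>2\<close>. Extensionality only makes the map unique as a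
  HOL function.\<close>

definition tensor_lift ::
  "('k, 'r) ring_scheme \<Rightarrow> ('k, 'm, 's) module_scheme \<Rightarrow> ('k, 'n, 't) module_scheme \<Rightarrow>
   ('k, 'p, 'u) module_scheme \<Rightarrow> ('m \<Rightarrow> 'n \<Rightarrow> 'p) \<Rightarrow> ('k, 'm, 'n) tensor \<Rightarrow> 'p"
  where "tensor_lift k M N P B =
     (THE h. h \<in> lin_maps k (tensor_module k M N) P \<and> h \<in> extensional (carrier (tensor_module k M N)) \<and>
        (\<forall>m\<in>carrier M. \<forall>n\<in>carrier N. h (pure_tensor k M N m n) = B m n))"

definition tensor_map ::
  "('k, 'r) ring_scheme \<Rightarrow> ('k, 'm, 's) module_scheme \<Rightarrow> ('k, 'n, 't) module_scheme \<Rightarrow>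
   ('k, 'p, 'u) module_scheme \<Rightarrow> ('k, 'q, 'v) module_scheme \<Rightarrow>
   ('m \<Rightarrow> 'p) \<Rightarrow> ('n \<Rightarrow> 'q) \<Rightarrow> ('k, 'm, 'n) tensor \<Rightarrow> ('k, 'p, 'q) tensor"
  where "tensor_map k M N P Q f g =
     tensor_lift k M N (tensor_module k P Q) (\<lambda>m n. pure_tensor k P Q (f m) (g n))"

text \<open>\<open>(M \<otimes> N) \<otimes> P \<rightarrow> M \<otimes> (N \<otimes> P)\<close>\<close>

definition tensor_assoc ::
  "('k, 'r) ring_scheme \<Rightarrow> ('k, 'm, 's) module_scheme \<Rightarrow> ('k, 'n, 't) module_scheme \<Rightarrow>
   ('k, 'p, 'u) module_scheme \<Rightarrow>
   ('k, ('k, 'm, 'n) tensor, 'p) tensor \<Rightarrow> ('k, 'm, ('k, 'n, 'p) tensor) tensor"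
  where "tensor_assoc k M N P =
     (let NP = tensor_module k N P; T = tensor_module k M NP in
      tensor_lift k (tensor_module k M N) P T
        (\<lambda>t p. tensor_lift k M N T (\<lambda>m n. pure_tensor k M NP m (pure_tensor k N P n p)) t))"

text \<open>\<open>(M \<otimes> M') \<otimes> (N \<otimes> N') \<rightarrow> (M \<otimes> N) \<otimes> (M' \<otimes> N')\<close>\<close>

definition tensor_interchange ::
  "('k, 'r) ring_scheme \<Rightarrow> ('k, 'm, 's) module_scheme \<Rightarrow> ('k, 'p, 't) module_scheme \<Rightarrow>
   ('k, 'n, 'u) module_scheme \<Rightarrow> ('k, 'q, 'v) module_scheme \<Rightarrow>
   ('k, ('k, 'm, 'p) tensor, ('k, 'n, 'q) tensor) tensor \<Rightarrow>
   ('k, ('k, 'm, 'n) tensor, ('k, 'p, 'q) tensor) tensor"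
  where "tensor_interchange k M M' N N' =
     (let MN = tensor_module k M N; MN' = tensor_module k M' N'; T = tensor_module k MN MN' in
      tensor_lift k (tensor_module k M M') (tensor_module k N N') T
        (\<lambda>s t. tensor_lift k M M' T (\<lambda>m m'. tensor_lift k N N' T
           (\<lambda>n n'. pure_tensor k MN MN' (pure_tensor k M N m n) (pure_tensor k M' N' m' n')) t) s))"

text \<open>\<open>k \<otimes> M \<rightarrow> M\<close> and \<open>M \<otimes> k \<rightarrow> M\<close>\<close>

definition tensor_unit_left ::
  "('k, 'r) ring_scheme \<Rightarrow> ('k, 'm, 's) module_scheme \<Rightarrow> ('k, 'k, 'm) tensor \<Rightarrow> 'm"
  where "tensor_unit_left k M = tensor_lift k (regular_module k) M M (\<lambda>r m. r \<odot>\<^bsub>M\<^esub> m)"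

definition tensor_unit_right ::
  "('k, 'r) ring_scheme \<Rightarrow> ('k, 'm, 's) module_scheme \<Rightarrow> ('k, 'm, 'k) tensor \<Rightarrow> 'm"
  where "tensor_unit_right k M = tensor_lift k M (regular_module k) M (\<lambda>m r. r \<odot>\<^bsub>M\<^esub> m)"


section \<open>Coalgebras and algebras in finitely generated projective modules\<close>

record ('k, 'm) coalgebra = "('k, 'm) module" +
  comult :: "'m \<Rightarrow> ('k, 'm, 'm) tensor"
  counit :: "'m \<Rightarrow> 'k"

definition fgp_coalgebra :: "('k, 'r) ring_scheme \<Rightarrow> ('k, 'm) coalgebra \<Rightarrow> bool"
  where "fgp_coalgebra k M \<longleftrightarrow> fg_projective k M \<and>
     comult M \<in> lin_maps k M (tensor_module k M M) \<and>
     counit M \<in> lin_maps k M (regular_module k) \<and>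
     (\<forall>a\<in>carrier M.
        tensor_assoc k M M M (tensor_map k M M (tensor_module k M M) M (comult M) id (comult M a)) =
        tensor_map k M M M (tensor_module k M M) id (comult M) (comult M a)) \<and>
     (\<forall>a\<in>carrier M.
        tensor_unit_left k M (tensor_map k M M (regular_module k) M (counit M) id (comult M a)) = a \<and>
        tensor_unit_right k M (tensor_map k M M M (regular_module k) id (counit M) (comult M a)) = a)"

definition coalgebra_homs ::
  "('k, 'r) ring_scheme \<Rightarrow> ('k, 'm) coalgebra \<Rightarrow> ('k, 'n) coalgebra \<Rightarrow> ('m \<Rightarrow> 'n) set"
  where "coalgebra_homs k M N = {f \<in> lin_maps k M N. \<forall>a\<in>carrier M.
     comult N (f a) = tensor_map k M M N N f f (comult M a) \<and> counit N (f a) = counit M a}"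

definition tensor_coalgebra ::
  "('k, 'r) ring_scheme \<Rightarrow> ('k, 'm) coalgebra \<Rightarrow> ('k, 'n) coalgebra \<Rightarrow>
   ('k, ('k, 'm, 'n) tensor) coalgebra"
  where "tensor_coalgebra k M N = module.extend (tensor_module k M N)
     (coalgebra.fields
       (\<lambda>t. tensor_interchange k M M N N
          (tensor_map k M N (tensor_module k M M) (tensor_module k N N) (comult M) (comult N) t))
       (tensor_lift k M N (regular_module k) (\<lambda>m n. counit M m \<otimes>\<^bsub>k\<^esub> counit N n)))"

definition unit_coalgebra :: "('k, 'r) ring_scheme \<Rightarrow> ('k, 'k) coalgebra"
  where "unit_coalgebra k = module.extend (regular_module k)
     (coalgebra.fields
       (\<lambda>r. pure_tensor k (regular_module k) (regular_module k) r \<one>\<^bsub>k\<^esub>)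
       (\<lambda>r. r))"

text \<open>The library's locale \<open>algebra\<close> requires a commutative multiplication.\<close>

definition fgp_algebra :: "('k, 'r) ring_scheme \<Rightarrow> ('k, 'm) module \<Rightarrow> bool"
  where "fgp_algebra k M \<longleftrightarrow> fg_projective k M \<and> ring M \<and>
     (\<forall>r\<in>carrier k. \<forall>x\<in>carrier M. \<forall>y\<in>carrier M.
        (r \<odot>\<^bsub>M\<^esub> x) \<otimes>\<^bsub>M\<^esub> y = r \<odot>\<^bsub>M\<^esub> (x \<otimes>\<^bsub>M\<^esub> y) \<and> x \<otimes>\<^bsub>M\<^esub> (r \<odot>\<^bsub>M\<^esub> y) = r \<odot>\<^bsub>M\<^esub> (x \<otimes>\<^bsub>M\<^esub> y))"

definition algebra_homs ::
  "('k, 'r) ring_scheme \<Rightarrow> ('k, 'm) module \<Rightarrow> ('k, 'n) module \<Rightarrow> ('m \<Rightarrow> 'n) set"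
  where "algebra_homs k M N = lin_maps k M N \<inter> ring_hom M N"

definition mult_map :: "('k, 'r) ring_scheme \<Rightarrow> ('k, 'm) module \<Rightarrow> ('k, 'm, 'm) tensor \<Rightarrow> 'm"
  where "mult_map k M = tensor_lift k M M M (\<lambda>x y. x \<otimes>\<^bsub>M\<^esub> y)"

definition unit_map :: "('k, 'm) module \<Rightarrow> 'k \<Rightarrow> 'm"
  where "unit_map M r = r \<odot>\<^bsub>M\<^esub> \<one>\<^bsub>M\<^esub>"

definition tensor_algebra ::
  "('k, 'r) ring_scheme \<Rightarrow> ('k, 'm) module \<Rightarrow> ('k, 'n) module \<Rightarrow> ('k, ('k, 'm, 'n) tensor) module"
  where "tensor_algebra k M N = (let T = tensor_module k M N in T\<lparr>
     mult := (\<lambda>s t. tensor_lift k M N T (\<lambda>m n. tensor_lift k M N T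
        (\<lambda>m' n'. pure_tensor k M N (m \<otimes>\<^bsub>M\<^esub> m') (n \<otimes>\<^bsub>N\<^esub> n')) t) s),
     one := pure_tensor k M N \<one>\<^bsub>M\<^esub> \<one>\<^bsub>N\<^esub>\<rparr>)"


section \<open>Hopf categories and dual Hopf categories\<close>

text \<open>\<open>comp_map A x y z\<close> is the composition map \<open>A\<^bsub>x,y\<^esub> \<otimes> A\<^bsub>y,z\<^esub> \<rightarrow> A\<^bsub>x,z\<^esub>\<close>.\<close>

record ('k, 'x, 'a) coalg_cat =
  mor :: "'x \<Rightarrow> 'x \<Rightarrow> ('k, 'a) coalgebra"
  comp_map :: "'x \<Rightarrow> 'x \<Rightarrow> 'x \<Rightarrow> ('k, 'a, 'a) tensor \<Rightarrow> 'a"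
  ident :: "'x \<Rightarrow> 'a"

definition mor_comp ::
  "('k, 'r) ring_scheme \<Rightarrow> ('k, 'x, 'a) coalg_cat \<Rightarrow> 'x \<Rightarrow> 'x \<Rightarrow> 'x \<Rightarrow> 'a \<Rightarrow> 'a \<Rightarrow> 'a"
  where "mor_comp k A x y z a b = comp_map A x y z (pure_tensor k (mor A x y) (mor A y z) a b)"

definition coalgebra_category ::
  "('k, 'r) ring_scheme \<Rightarrow> 'x set \<Rightarrow> ('k, 'x, 'a) coalg_cat \<Rightarrow> bool"
  where "coalgebra_category k X A \<longleftrightarrow>
     (\<forall>x\<in>X. \<forall>y\<in>X. fgp_coalgebra k (mor A x y)) \<and>
     (\<forall>x\<in>X. \<forall>y\<in>X. \<forall>z\<in>X.
        comp_map A x y z \<in> coalgebra_homs k (tensor_coalgebra k (mor A x y) (mor A y z)) (mor A x z)) \<and>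
     (\<forall>x\<in>X. ident A x \<in> carrier (mor A x x) \<and>
        (\<lambda>r. r \<odot>\<^bsub>mor A x x\<^esub> ident A x) \<in> coalgebra_homs k (unit_coalgebra k) (mor A x x)) \<and>
     (\<forall>x\<in>X. \<forall>y\<in>X. \<forall>z\<in>X. \<forall>u\<in>X.
        \<forall>a\<in>carrier (mor A x y). \<forall>b\<in>carrier (mor A y z). \<forall>c\<in>carrier (mor A z u).
        mor_comp k A x z u (mor_comp k A x y z a b) c = mor_comp k A x y u a (mor_comp k A y z u b c)) \<and>
     (\<forall>x\<in>X. \<forall>y\<in>X. \<forall>a\<in>carrier (mor A x y).
        mor_comp k A x x y (ident A x) a = a \<and> mor_comp k A x y y a (ident A y) = a)"

definition hopf_category ::
  "('k, 'r) ring_scheme \<Rightarrow> 'x set \<Rightarrow> ('k, 'x, 'a) coalg_cat \<Rightarrow> bool"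
  where "hopf_category k X A \<longleftrightarrow> coalgebra_category k X A \<and>
     (\<exists>S :: 'x \<Rightarrow> 'x \<Rightarrow> 'a \<Rightarrow> 'a.
        (\<forall>x\<in>X. \<forall>y\<in>X. S x y \<in> lin_maps k (mor A x y) (mor A y x)) \<and>
        (\<forall>x\<in>X. \<forall>y\<in>X. \<forall>a\<in>carrier (mor A x y).
           comp_map A x y x (tensor_map k (mor A x y) (mor A x y) (mor A x y) (mor A y x)
              id (S x y) (comult (mor A x y) a)) =
             counit (mor A x y) a \<odot>\<^bsub>mor A x x\<^esub> ident A x \<and>
           comp_map A y x y (tensor_map k (mor A x y) (mor A x y) (mor A y x) (mor A x y)
              (S x y) id (comult (mor A x y) a)) =
             counit (mor A x y) a \<odot>\<^bsub>mor A y y\<^esub> ident A y))"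

text \<open>\<open>cocomp C x y z\<close> is \<open>\<Delta>\<^bsub>x,y,z\<^esub> : C\<^bsub>x,z\<^esub> \<rightarrow> C\<^bsub>x,y\<^esub> \<otimes> C\<^bsub>y,z\<^esub>\<close> and \<open>coident C x\<close> is \<open>\<epsilon>\<^sub>x : C\<^bsub>x,x\<^esub> \<rightarrow> k\<close>.\<close>

record ('k, 'x, 'c) dual_alg_cat =
  dhom :: "'x \<Rightarrow> 'x \<Rightarrow> ('k, 'c) module"
  cocomp :: "'x \<Rightarrow> 'x \<Rightarrow> 'x \<Rightarrow> 'c \<Rightarrow> ('k, 'c, 'c) tensor"
  coident :: "'x \<Rightarrow> 'c \<Rightarrow> 'k"

definition dual_algebra_category ::
  "('k, 'r) ring_scheme \<Rightarrow> 'x set \<Rightarrow> ('k, 'x, 'c) dual_alg_cat \<Rightarrow> bool"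
  where "dual_algebra_category k X C \<longleftrightarrow>
     (\<forall>x\<in>X. \<forall>y\<in>X. fgp_algebra k (dhom C x y)) \<and>
     (\<forall>x\<in>X. \<forall>y\<in>X. \<forall>z\<in>X.
        cocomp C x y z \<in> algebra_homs k (dhom C x z) (tensor_algebra k (dhom C x y) (dhom C y z))) \<and>
     (\<forall>x\<in>X. coident C x \<in> algebra_homs k (dhom C x x) (regular_module k)) \<and>
     (\<forall>x\<in>X. \<forall>y\<in>X. \<forall>z\<in>X. \<forall>u\<in>X. \<forall>c\<in>carrier (dhom C x u).
        tensor_assoc k (dhom C x y) (dhom C y z) (dhom C z u)
          (tensor_map k (dhom C x z) (dhom C z u)
             (tensor_module k (dhom C x y) (dhom C y z)) (dhom C z u)
             (cocomp C x y z) id (cocomp C x z u c)) =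
        tensor_map k (dhom C x y) (dhom C y u)
          (dhom C x y) (tensor_module k (dhom C y z) (dhom C z u))
          id (cocomp C y z u) (cocomp C x y u c)) \<and>
     (\<forall>x\<in>X. \<forall>y\<in>X. \<forall>c\<in>carrier (dhom C x y).
        tensor_unit_left k (dhom C x y)
          (tensor_map k (dhom C x x) (dhom C x y) (regular_module k) (dhom C x y)
             (coident C x) id (cocomp C x x y c)) = c \<and>
        tensor_unit_right k (dhom C x y)
          (tensor_map k (dhom C x y) (dhom C y y) (dhom C x y) (regular_module k)
             id (coident C y) (cocomp C x y y c)) = c)"

definition dual_hopf_category ::
  "('k, 'r) ring_scheme \<Rightarrow> 'x set \<Rightarrow> ('k, 'x, 'c) dual_alg_cat \<Rightarrow> bool"
  where "dual_hopf_category k X C \<longleftrightarrow> dual_algebra_category k X C \<and>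
     (\<exists>S :: 'x \<Rightarrow> 'x \<Rightarrow> 'c \<Rightarrow> 'c.
        (\<forall>x\<in>X. \<forall>y\<in>X. S x y \<in> lin_maps k (dhom C y x) (dhom C x y)) \<and>
        (\<forall>x\<in>X. \<forall>y\<in>X. \<forall>c\<in>carrier (dhom C x x).
           mult_map k (dhom C x y)
             (tensor_map k (dhom C x y) (dhom C y x) (dhom C x y) (dhom C x y)
                id (S x y) (cocomp C x y x c)) =
             unit_map (dhom C x y) (coident C x c) \<and>
           mult_map k (dhom C y x)
             (tensor_map k (dhom C x y) (dhom C y x) (dhom C y x) (dhom C y x)
                (S y x) id (cocomp C x y x c)) =
             unit_map (dhom C y x) (coident C x c)))"


section \<open>The duality\<close>

text \<open>The dual \<open>M\<^sup>*\<close> of a coalgebra, with multiplication the opposite convolution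
  \<open>\<langle>cd,a\<rangle> = \<langle>c,a\<^sub>2\<rangle>\<langle>d,a\<^sub>1\<rangle>\<close>. Linear forms are represented by extensional functions on the carrier
  of \<open>M\<close>.\<close>

definition dual_algebra ::
  "('k, 'r) ring_scheme \<Rightarrow> ('k, 'm) coalgebra \<Rightarrow> ('k, 'm \<Rightarrow> 'k) module"
  where "dual_algebra k M = \<lparr>
     carrier = lin_maps k M (regular_module k) \<inter> extensional (carrier M),
     mult = (\<lambda>c d. \<lambda>a\<in>carrier M.
        tensor_lift k M M (regular_module k) (\<lambda>a1 a2. c a2 \<otimes>\<^bsub>k\<^esub> d a1) (comult M a)),
     one = (\<lambda>a\<in>carrier M. counit M a),
     zero = (\<lambda>a\<in>carrier M. \<zero>\<^bsub>k\<^esub>),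
     add = (\<lambda>c d. \<lambda>a\<in>carrier M. c a \<oplus>\<^bsub>k\<^esub> d a),
     smult = (\<lambda>r c. \<lambda>a\<in>carrier M. r \<otimes>\<^bsub>k\<^esub> c a)\<rparr>"

text \<open>The image of \<open>A\<close> under the duality: \<open>C\<^bsub>x,y\<^esub> = A\<^bsub>y,x\<^esub>\<^sup>*\<close>, and \<open>\<Delta>\<^bsub>z,y,x\<^esub> c\<close> is the element
  \<open>c\<^sub>1 \<otimes> c\<^sub>2\<close> of \<open>C\<^bsub>z,y\<^esub> \<otimes> C\<^bsub>y,x\<^esub>\<close> determined by \<open>\<langle>c,ab\<rangle> = \<langle>c\<^sub>2,a\<rangle>\<langle>c\<^sub>1,b\<rangle>\<close>.\<close>

definition dual_category ::
  "('k, 'r) ring_scheme \<Rightarrow> ('k, 'x, 'a) coalg_cat \<Rightarrow> ('k, 'x, 'a \<Rightarrow> 'k) dual_alg_cat"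
  where "dual_category k A = \<lparr>
     dhom = (\<lambda>x y. dual_algebra k (mor A y x)),
     cocomp = (\<lambda>z y x c.
        let D1 = dual_algebra k (mor A y z); D2 = dual_algebra k (mor A x y) in
        THE t. t \<in> carrier (tensor_module k D1 D2) \<and>
          (\<forall>a\<in>carrier (mor A x y). \<forall>b\<in>carrier (mor A y z).
             c (mor_comp k A x y z a b) =
             tensor_lift k D1 D2 (regular_module k) (\<lambda>c1 c2. c2 a \<otimes>\<^bsub>k\<^esub> c1 b) t)),
     coident = (\<lambda>x c. c (ident A x))\<rparr>"

definition dual_alg_cat_iso ::
  "('k, 'r) ring_scheme \<Rightarrow> 'x set \<Rightarrow> ('k, 'x, 'c) dual_alg_cat \<Rightarrow> ('k, 'x, 'd) dual_alg_cat \<Rightarrow>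
   ('x \<Rightarrow> 'x \<Rightarrow> 'c \<Rightarrow> 'd) \<Rightarrow> bool"
  where "dual_alg_cat_iso k X C D \<phi> \<longleftrightarrow>
     (\<forall>x\<in>X. \<forall>y\<in>X. \<phi> x y \<in> algebra_homs k (dhom C x y) (dhom D x y) \<and>
        bij_betw (\<phi> x y) (carrier (dhom C x y)) (carrier (dhom D x y))) \<and>
     (\<forall>x\<in>X. \<forall>y\<in>X. \<forall>z\<in>X. \<forall>c\<in>carrier (dhom C x z).
        cocomp D x y z (\<phi> x z c) =
        tensor_map k (dhom C x y) (dhom C y z) (dhom D x y) (dhom D y z)
          (\<phi> x y) (\<phi> y z) (cocomp C x y z c)) \<and>
     (\<forall>x\<in>X. \<forall>c\<in>carrier (dhom C x x). coident D x (\<phi> x x c) = coident C x c)"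

text \<open>\<open>A\<close> and \<open>C\<close> correspond to each other if \<open>C\<close> is, up to an isomorphism that is the identity on
  objects, the dual of \<open>A\<close>. Allowing an isomorphism covers both \<open>C\<^bsub>x,y\<^esub> = A\<^bsub>y,x\<^esub>\<^sup>*\<close> and, via the canonical
  identification of \<open>C\<^bsub>x,y\<^esub>\<close> with its bidual, \<open>A\<^bsub>x,y\<^esub> = C\<^bsub>y,x\<^esub>\<^sup>*\<close>.\<close>

definition correspond ::
  "('k, 'r) ring_scheme \<Rightarrow> 'x set \<Rightarrow> ('k, 'x, 'a) coalg_cat \<Rightarrow> ('k, 'x, 'c) dual_alg_cat \<Rightarrow> bool"
  where "correspond k X A C \<longleftrightarrow> (\<exists>\<phi>. dual_alg_cat_iso k X C (dual_category k A) \<phi>)"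

end

theory Submission
  imports Defs
begin

text \<open>An antipode of \<open>C\<close> is the transpose of an antipode of \<open>A\<close>. Write \<open>\<langle>c, a\<rangle>\<close> for the pairing of
  \<open>C\<^bsub>x,y\<^esub>\<close> with \<open>A\<^bsub>y,x\<^esub>\<close> and let \<open>\<langle>\<sigma> c, a\<rangle> = \<langle>c, s a\<rangle>\<close>. The formulas for the cocomposition and for the opposite
  convolution give, for \<open>c\<close> in \<open>C\<^bsub>x,x\<^esub>\<close>,
  \<open>\<langle>c\<^sub>1 \<sigma>(c\<^sub>2), a\<rangle> = \<langle>c\<^sub>1, a\<^sub>2\<rangle>\<langle>c\<^sub>2, s(a\<^sub>1)\<rangle> = \<langle>c, s(a\<^sub>1) a\<^sub>2\<rangle>\<close>, and likewise on the other side; also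
  \<open>\<langle>\<epsilon>(c)1, a\<rangle> = \<langle>c, \<epsilon>(a)1\<^sub>x\<rangle>\<close>. Since elements of finitely generated projective modules are separated by linear
  forms, one antipode equation holds if and only if the transposed one does, and by reflexivity every
  linear map \<open>\<sigma>\<close> between the duals is a transpose.\<close>

section \<open>Linear maps, quotient modules and free modules\<close>

text \<open>The cocomposition of the dual is a definite description, so nothing can be said of it
  until a bilinear form is known to come from exactly one tensor of the dual modules. This is the
  isomorphism between the tensor product of duals and the dual of the tensor product. Together with
  separation and reflexivity it is where finite generation and projectivity enter, and all three are
  read off from a dual basis. In the computation with antipodes tensors are not expanded: a Sweedler
  expression is a \<open>tensor_lift\<close>, substitution into it is
  \<open>tensor_lift_tensor_map\<close>, and the exchange of the Sweedler sums of \<open>c\<close>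
  and of \<open>a\<close>, which the displayed formula performs silently, is
  \<open>tensor_lift_swap\<close>. Since \<open>C\<close> is merely isomorphic to the dual of
  \<open>A\<close>, the pairing is carried by that isomorphism \<phi>. The two reversals, of indices
  and of multiplication, have a visible effect: the transpose of \<open>S x y\<close> is
  \<open>T y x\<close>, and a right antipode equation on one side becomes a left one on the
  other.\<close>

lemma lin_mapsI:
  assumes "\<And>x. x \<in> carrier M \<Longrightarrow> f x \<in> carrier N"
    and "\<And>x y. x \<in> carrier M \<Longrightarrow> y \<in> carrier M \<Longrightarrow> f (x \<oplus>\<^bsub>M\<^esub> y) = f x \<oplus>\<^bsub>N\<^esub> f y"
    and "\<And>r x. r \<in> carrier k \<Longrightarrow> x \<in> carrier M \<Longrightarrow> f (r \<odot>\<^bsub>M\<^esub> x) = r \<odot>\<^bsub>N\<^esub> f x"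
  shows "f \<in> lin_maps k M N"
  using assms by (simp add: lin_maps_def)

lemma lin_maps_closed: "f \<in> lin_maps k M N \<Longrightarrow> x \<in> carrier M \<Longrightarrow> f x \<in> carrier N"
  and lin_maps_add: "f \<in> lin_maps k M N \<Longrightarrow> x \<in> carrier M \<Longrightarrow> y \<in> carrier M \<Longrightarrow>
    f (x \<oplus>\<^bsub>M\<^esub> y) = f x \<oplus>\<^bsub>N\<^esub> f y"
  and lin_maps_smult: "f \<in> lin_maps k M N \<Longrightarrow> r \<in> carrier k \<Longrightarrow> x \<in> carrier M \<Longrightarrow>
    f (r \<odot>\<^bsub>M\<^esub> x) = r \<odot>\<^bsub>N\<^esub> f x"
  by (auto simp: lin_maps_def)

lemma lin_maps_id: "id \<in> lin_maps k M M"
  by (simp add: lin_maps_def)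

lemma lin_maps_compose:
  assumes "f \<in> lin_maps k M N" "g \<in> lin_maps k N P"
  shows "(\<lambda>x. g (f x)) \<in> lin_maps k M P"
  using assms by (auto simp: lin_maps_def Pi_iff)

lemma lin_maps_zero:
  assumes "module k M" "module k N" "f \<in> lin_maps k M N"
  shows "f \<zero>\<^bsub>M\<^esub> = \<zero>\<^bsub>N\<^esub>"
proof -
  interpret M: module k M by fact
  interpret N: module k N by fact
  have "f (\<zero>\<^bsub>k\<^esub> \<odot>\<^bsub>M\<^esub> \<zero>\<^bsub>M\<^esub>) = \<zero>\<^bsub>k\<^esub> \<odot>\<^bsub>N\<^esub> f \<zero>\<^bsub>M\<^esub>"
    by (rule lin_maps_smult[OF assms(3)]) simp_all
  then show ?thesis
    using assms(3) by (simp add: lin_maps_closed)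
qed

lemma lin_maps_a_inv:
  assumes "module k M" "module k N" "f \<in> lin_maps k M N" "x \<in> carrier M"
  shows "f (\<ominus>\<^bsub>M\<^esub> x) = \<ominus>\<^bsub>N\<^esub> f x"
proof -
  interpret M: module k M by fact
  interpret N: module k N by fact
  have "f (\<ominus>\<^bsub>M\<^esub> x) = f ((\<ominus>\<^bsub>k\<^esub> \<one>\<^bsub>k\<^esub>) \<odot>\<^bsub>M\<^esub> x)"
    using assms(4) by (simp add: M.smult_l_minus)
  also have "\<dots> = \<ominus>\<^bsub>N\<^esub> f x"
    using assms(3,4) by (simp add: lin_maps_smult lin_maps_closed N.smult_l_minus)
  finally show ?thesis .
qed

lemma lin_maps_a_minus:
  assumes "module k M" "module k N" "f \<in> lin_maps k M N" "x \<in> carrier M" "y \<in> carrier M"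
  shows "f (x \<ominus>\<^bsub>M\<^esub> y) = f x \<ominus>\<^bsub>N\<^esub> f y"
proof -
  interpret M: module k M by fact
  show ?thesis
    using assms by (simp add: a_minus_def lin_maps_add lin_maps_a_inv)
qed

lemma lin_maps_cong:
  assumes "module k M" "\<And>x. x \<in> carrier M \<Longrightarrow> f x = g x"
  shows "f \<in> lin_maps k M N \<longleftrightarrow> g \<in> lin_maps k M N"
proof -
  interpret module k M by fact
  show ?thesis
    using assms(2) by (auto simp: lin_maps_def Pi_iff)
qed

lemma lin_maps_sum:
  assumes P: "module k P" and f: "f \<in> lin_maps k M P" and g: "g \<in> lin_maps k M P"
  shows "(\<lambda>x. f x \<oplus>\<^bsub>P\<^esub> g x) \<in> lin_maps k M P"
proof -
  interpret P: module k P by (rule P)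
  show ?thesis
    by (rule lin_mapsI)
      (simp_all add: lin_maps_closed[OF f] lin_maps_closed[OF g] lin_maps_add[OF f] lin_maps_add[OF g]
        lin_maps_smult[OF f] lin_maps_smult[OF g] P.smult_r_distr P.a_ac)
qed

lemma restrict_lin_maps:
  assumes "module k M" "f \<in> lin_maps k M N"
  shows "restrict f (carrier M) \<in> lin_maps k M N"
proof -
  interpret module k M by fact
  show ?thesis
    by (rule lin_mapsI) (simp_all add: lin_maps_closed[OF assms(2)] lin_maps_add[OF assms(2)] lin_maps_smult[OF assms(2)])
qed

lemma lin_maps_inv_into:
  assumes M: "module k M" and f: "f \<in> lin_maps k M N" and bij: "bij_betw f (carrier M) (carrier N)"
  shows "inv_into (carrier M) f \<in> lin_maps k N M"
proof (rule lin_mapsI)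
  interpret M: module k M by (rule M)
  let ?g = "inv_into (carrier M) f"
  have g: "?g y \<in> carrier M" "f (?g y) = y" if "y \<in> carrier N" for y
    using that bij by (auto simp: bij_betw_def inv_into_into f_inv_into_f)
  have gf: "?g (f x) = x" if "x \<in> carrier M" for x
    using that bij by (simp add: bij_betw_def)
  show "?g y \<in> carrier M" if "y \<in> carrier N" for y
    using g(1)[OF that] .
  show "?g (x \<oplus>\<^bsub>N\<^esub> y) = ?g x \<oplus>\<^bsub>M\<^esub> ?g y" if "x \<in> carrier N" "y \<in> carrier N" for x y
    using gf[of "?g x \<oplus>\<^bsub>M\<^esub> ?g y"] lin_maps_add[OF f g(1)[OF that(1)] g(1)[OF that(2)]] g that by simp
  show "?g (r \<odot>\<^bsub>N\<^esub> y) = r \<odot>\<^bsub>M\<^esub> ?g y" if "r \<in> carrier k" "y \<in> carrier N" for r y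
    using gf[of "r \<odot>\<^bsub>M\<^esub> ?g y"] lin_maps_smult[OF f that(1) g(1)[OF that(2)]] g that by simp
qed

lemma lin_maps_finsum:
  assumes "module k M" "module k N" "f \<in> lin_maps k M N" "finite I" "g \<in> I \<rightarrow> carrier M"
  shows "f (\<Oplus>\<^bsub>M\<^esub>i\<in>I. g i) = (\<Oplus>\<^bsub>N\<^esub>i\<in>I. f (g i))"
proof -
  interpret M: module k M by fact
  interpret N: module k N by fact
  show ?thesis
    using assms(4,5)
  proof (induction I)
    case empty
    then show ?case by (simp add: lin_maps_zero[OF assms(1-3)])
  next
    case (insert i I)
    have "(\<lambda>i. f (g i)) \<in> I \<rightarrow> carrier N"
      using insert.prems by (auto intro!: lin_maps_closed[OF assms(3)])
    then show ?case
      using insert by (simp add: lin_maps_add[OF assms(3)] lin_maps_closed[OF assms(3)] Pi_iff)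
  qed
qed

section \<open>The ground ring and the free modules as modules\<close>

lemma module_regular_module:
  fixes k (structure)
  assumes "cring k"
  shows "module k (regular_module k)"
proof -
  interpret cring k by fact
  show ?thesis
  proof (rule moduleI)
    show "abelian_group (regular_module k)"
    proof (rule abelian_groupI)
      fix x assume "x \<in> carrier (regular_module k)"
      then show "\<exists>y\<in>carrier (regular_module k). y \<oplus>\<^bsub>regular_module k\<^esub> x = \<zero>\<^bsub>regular_module k\<^esub>"
        by (intro bexI[of _ "\<ominus> x"]) (simp_all add: regular_module_def l_neg)
    qed (simp_all add: regular_module_def a_ac)
  qed (simp_all add: regular_module_def is_cring l_distr r_distr m_assoc)
qed

lemma regular_module_simps [simp]:
  "carrier (regular_module k) = carrier k"
  "\<zero>\<^bsub>regular_module k\<^esub> = \<zero>\<^bsub>k\<^esub>"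
  "x \<oplus>\<^bsub>regular_module k\<^esub> y = x \<oplus>\<^bsub>k\<^esub> y"
  "x \<odot>\<^bsub>regular_module k\<^esub> y = x \<otimes>\<^bsub>k\<^esub> y"
  by (simp_all add: regular_module_def)

lemma module_free_module:
  fixes k :: "('k, 'r) ring_scheme" (structure) and I :: "'i set"
  assumes "cring k"
  shows "module k (free_module k I)"
proof -
  interpret cring k by fact
  have fin_add: "finite {i. f i \<oplus> g i \<noteq> \<zero>}"
    if "finite {i. f i \<noteq> \<zero>}" "finite {i. g i \<noteq> \<zero>}" for f g :: "'i \<Rightarrow> 'k"
    by (rule finite_subset[of _ "{i. f i \<noteq> \<zero>} \<union> {i. g i \<noteq> \<zero>}"]) (use that in auto)
  have fin_smult: "finite {i. r \<otimes> f i \<noteq> \<zero>}"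
    if "finite {i. f i \<noteq> \<zero>}" "r \<in> carrier k" for r and f :: "'i \<Rightarrow> 'k"
    by (rule finite_subset[OF _ that(1)]) (use that in auto)
  have neg: "\<exists>g\<in>{f. (\<forall>i. f i \<in> carrier k) \<and> (\<forall>i. i \<notin> I \<longrightarrow> f i = \<zero>) \<and> finite {i. f i \<noteq> \<zero>}}.
      (\<lambda>i. g i \<oplus> f i) = (\<lambda>i. \<zero>)"
    if "\<forall>i. f i \<in> carrier k" "\<forall>i. i \<notin> I \<longrightarrow> f i = \<zero>" "finite {i. f i \<noteq> \<zero>}" for f :: "'i \<Rightarrow> 'k"
  proof (rule bexI)
    show "(\<lambda>i. (\<ominus> f i) \<oplus> f i) = (\<lambda>i. \<zero>)"
      using that by (simp add: l_neg)
    have "finite {i. \<ominus> f i \<noteq> \<zero>}"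
      by (rule finite_subset[OF _ that(3)]) auto
    then show "(\<lambda>i. \<ominus> f i) \<in> {f. (\<forall>i. f i \<in> carrier k) \<and> (\<forall>i. i \<notin> I \<longrightarrow> f i = \<zero>) \<and> finite {i. f i \<noteq> \<zero>}}"
      using that by auto
  qed
  show ?thesis
  proof (rule moduleI)
    show "abelian_group (free_module k I)"
    proof (rule abelian_groupI)
      fix f assume "f \<in> carrier (free_module k I)"
      then show "\<exists>g\<in>carrier (free_module k I). g \<oplus>\<^bsub>free_module k I\<^esub> f = \<zero>\<^bsub>free_module k I\<^esub>"
        using neg[of f] by (simp add: free_module_def)
    qed (auto simp: free_module_def fin_add a_ac)
  qed (auto simp: free_module_def is_cring fin_smult l_distr r_distr m_assoc)
qed

lemma free_module_simps [simp]:
  "\<zero>\<^bsub>free_module k I\<^esub> = (\<lambda>i. \<zero>\<^bsub>k\<^esub>)"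
  "f \<oplus>\<^bsub>free_module k I\<^esub> g = (\<lambda>i. f i \<oplus>\<^bsub>k\<^esub> g i)"
  "r \<odot>\<^bsub>free_module k I\<^esub> f = (\<lambda>i. r \<otimes>\<^bsub>k\<^esub> f i)"
  by (simp_all add: free_module_def)

lemma free_gen_closed:
  assumes "cring k" "i \<in> I"
  shows "free_gen k i \<in> carrier (free_module k I)"
proof -
  interpret cring k by fact
  have "finite {j. (if j = i then \<one>\<^bsub>k\<^esub> else \<zero>\<^bsub>k\<^esub>) \<noteq> \<zero>\<^bsub>k\<^esub>}"
    by (rule finite_subset[of _ "{i}"]) auto
  then show ?thesis
    using assms(2) by (auto simp: free_module_def free_gen_def)
qed

section \<open>Quotients by submodules and their universal property\<close>

context
  fixes k :: "('k, 'r) ring_scheme" and M :: "('k, 'm, 's) module_scheme" and H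
  assumes M: "module k M" and H: "submodule H k M"
begin

interpretation M: module k M by (rule M)
interpretation H: submodule H k M by (rule H)
interpretation H: abelian_subgroup H M
  by (rule abelian_subgroupI3[OF additive_subgroupI]) (unfold_locales)

lemma quotient_module_carrier:
  "carrier (quotient_module k M H) = (\<lambda>x. H +>\<^bsub>M\<^esub> x) ` carrier M"
  by (auto simp: quotient_module_def A_RCOSETS_def')

lemma coset_eq_iff:
  assumes "x \<in> carrier M" "y \<in> carrier M"
  shows "H +>\<^bsub>M\<^esub> x = H +>\<^bsub>M\<^esub> y \<longleftrightarrow> x \<ominus>\<^bsub>M\<^esub> y \<in> H"
  using assms H.a_rcos_module[of y x]
  by (metis H.a_rcos_self H.a_repr_independence' M.minus_eq)

lemma quotient_module_add:
  assumes "x \<in> carrier M" "y \<in> carrier M"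
  shows "(H +>\<^bsub>M\<^esub> x) \<oplus>\<^bsub>quotient_module k M H\<^esub> (H +>\<^bsub>M\<^esub> y) = H +>\<^bsub>M\<^esub> (x \<oplus>\<^bsub>M\<^esub> y)"
  using assms by (simp add: quotient_module_def H.a_rcos_sum)

text \<open>The quotient defines the scalar action by a union over all representatives
  \<open>u\<close> of the coset. As \<open>H\<close> is stable under scalars, the multiples of
  \<open>u\<close> and of \<open>x\<close> differ by an element of \<open>H\<close>, so all members
  of this nonempty union are one and the same coset.\<close>

lemma quotient_module_smult:
  assumes r: "r \<in> carrier k" and x: "x \<in> carrier M"
  shows "r \<odot>\<^bsub>quotient_module k M H\<^esub> (H +>\<^bsub>M\<^esub> x) = H +>\<^bsub>M\<^esub> (r \<odot>\<^bsub>M\<^esub> x)"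
proof -
  have eq: "H +>\<^bsub>M\<^esub> (r \<odot>\<^bsub>M\<^esub> u) = H +>\<^bsub>M\<^esub> (r \<odot>\<^bsub>M\<^esub> x)" if "u \<in> H +>\<^bsub>M\<^esub> x" for u
  proof -
    have u: "u \<in> carrier M"
      using that x H.a_elemrcos_carrier by blast
    have "u \<ominus>\<^bsub>M\<^esub> x \<in> H"
      using that x u H.a_rcos_module[of x u] by (simp add: M.minus_eq)
    then have "r \<odot>\<^bsub>M\<^esub> (u \<ominus>\<^bsub>M\<^esub> x) \<in> H"
      using r by simp
    then show ?thesis
      using r x u by (subst coset_eq_iff) (simp_all add: M.minus_eq M.smult_r_distr M.smult_r_minus)
  qed
  have "x \<in> H +>\<^bsub>M\<^esub> x"
    using x by (rule H.a_rcos_self)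
  then have "(\<Union>u\<in>H +>\<^bsub>M\<^esub> x. H +>\<^bsub>M\<^esub> (r \<odot>\<^bsub>M\<^esub> u)) = H +>\<^bsub>M\<^esub> (r \<odot>\<^bsub>M\<^esub> x)"
    using eq by blast
  then show ?thesis
    by (simp add: quotient_module_def)
qed

lemma quotient_module_zero: "\<zero>\<^bsub>quotient_module k M H\<^esub> = H +>\<^bsub>M\<^esub> \<zero>\<^bsub>M\<^esub>"
  by (simp add: quotient_module_def H.a_subset)

lemma module_quotient_module: "module k (quotient_module k M H)"
proof -
  have neg: "\<exists>y\<in>carrier M. H +>\<^bsub>M\<^esub> (x \<oplus>\<^bsub>M\<^esub> y) = H +>\<^bsub>M\<^esub> \<zero>\<^bsub>M\<^esub>" if "x \<in> carrier M" for x
    using that by (intro bexI[of _ "\<ominus>\<^bsub>M\<^esub> x"]) (simp_all add: M.r_neg)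
  note simps = quotient_module_carrier quotient_module_add quotient_module_smult quotient_module_zero
  show ?thesis
  proof (rule moduleI)
    show "abelian_group (quotient_module k M H)"
    proof (rule abelian_groupI)
      fix U assume "U \<in> carrier (quotient_module k M H)"
      then obtain x where x: "x \<in> carrier M" "U = H +>\<^bsub>M\<^esub> x"
        by (auto simp: quotient_module_carrier)
      then show "\<exists>V\<in>carrier (quotient_module k M H). V \<oplus>\<^bsub>quotient_module k M H\<^esub> U = \<zero>\<^bsub>quotient_module k M H\<^esub>"
        using neg[OF x(1)] by (auto simp: simps M.a_comm)
    qed (auto simp: simps M.a_ac)
  qed (auto simp: simps M.is_cring M.smult_l_distr M.smult_r_distr M.smult_assoc1)
qed

text \<open>Since \<open>f\<close> kills \<open>H\<close>, it is constant on every coset, and the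
  induced map takes the only element of the image of a coset.\<close>

lemma quotient_module_lift:
  assumes P: "module k P" and f: "f \<in> lin_maps k M P" and ker: "\<And>x. x \<in> H \<Longrightarrow> f x = \<zero>\<^bsub>P\<^esub>"
  shows "\<exists>h \<in> lin_maps k (quotient_module k M H) P. \<forall>x\<in>carrier M. h (H +>\<^bsub>M\<^esub> x) = f x"
proof -
  interpret P: module k P by (rule P)
  define h where "h U = the_elem (f ` U)" for U
  have h: "h (H +>\<^bsub>M\<^esub> x) = f x" if x: "x \<in> carrier M" for x
  proof -
    have "f u = f x" if "u \<in> H +>\<^bsub>M\<^esub> x" for u
    proof -
      have u: "u \<in> carrier M"
        using that x H.a_elemrcos_carrier by blast
      have "u \<ominus>\<^bsub>M\<^esub> x \<in> H"
        using that x u H.a_rcos_module[of x u] by (simp add: M.minus_eq)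
      then have eq: "f u \<ominus>\<^bsub>P\<^esub> f x = \<zero>\<^bsub>P\<^esub>"
        using ker[of "u \<ominus>\<^bsub>M\<^esub> x"] lin_maps_a_minus[OF M P f u x] by simp
      have "f u = f x \<oplus>\<^bsub>P\<^esub> (f u \<ominus>\<^bsub>P\<^esub> f x)"
        using lin_maps_closed[OF f u] lin_maps_closed[OF f x]
        by (simp add: P.minus_eq P.a_lcomm P.r_neg)
      also have "\<dots> = f x"
        unfolding eq using lin_maps_closed[OF f x] by simp
      finally show ?thesis .
    qed
    then have "f ` (H +>\<^bsub>M\<^esub> x) = {f x}"
      using H.a_rcos_self[OF x] by blast
    then show ?thesis
      by (simp add: h_def)
  qed
  have "h \<in> lin_maps k (quotient_module k M H) P"
    by (rule lin_mapsI)
      (auto simp: quotient_module_carrier quotient_module_add quotient_module_smult h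
        lin_maps_closed[OF f] lin_maps_add[OF f] lin_maps_smult[OF f])
  then show ?thesis
    using h by blast
qed

end

text \<open>Induction on the finite support: erasing the value at one index splits off a scaled
  generator. The zero function is a case of its own because \<open>I\<close> may be empty.\<close>

lemma free_module_induct [consumes 2, case_names zero gen add]:
  assumes k: "cring k" and f: "f \<in> carrier (free_module k I)"
    and zero: "Q (\<lambda>i. \<zero>\<^bsub>k\<^esub>)"
    and gen: "\<And>r i. r \<in> carrier k \<Longrightarrow> i \<in> I \<Longrightarrow> Q (\<lambda>j. r \<otimes>\<^bsub>k\<^esub> free_gen k i j)"
    and add: "\<And>f g. f \<in> carrier (free_module k I) \<Longrightarrow> g \<in> carrier (free_module k I) \<Longrightarrow>
      Q f \<Longrightarrow> Q g \<Longrightarrow> Q (\<lambda>i. f i \<oplus>\<^bsub>k\<^esub> g i)"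
  shows "Q f"
proof -
  interpret cring k by (rule k)
  interpret F: module k "free_module k I" by (rule module_free_module[OF k])
  have "finite {i. f i \<noteq> \<zero>\<^bsub>k\<^esub>}"
    using f by (simp add: free_module_def)
  then show ?thesis
    using f
  proof (induction "{i. f i \<noteq> \<zero>\<^bsub>k\<^esub>}" arbitrary: f rule: finite_induct)
    case empty
    then have "f = (\<lambda>i. \<zero>\<^bsub>k\<^esub>)"
      by auto
    then show ?case
      using zero by simp
  next
    case (insert i S)
    have fi: "f i \<in> carrier k" "f i \<noteq> \<zero>\<^bsub>k\<^esub>" "i \<in> I" and fc: "\<And>j. f j \<in> carrier k"
      using insert.prems insert.hyps(4) by (auto simp: free_module_def)
    define g where "g = f(i := \<zero>\<^bsub>k\<^esub>)"
    have S: "S = {j. g j \<noteq> \<zero>\<^bsub>k\<^esub>}"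
      using insert.hyps(2,4) by (auto simp: g_def)
    have g: "g \<in> carrier (free_module k I)"
      using insert.prems insert.hyps(1) unfolding S by (auto simp: free_module_def g_def)
    have e: "(\<lambda>j. f i \<otimes>\<^bsub>k\<^esub> free_gen k i j) \<in> carrier (free_module k I)"
      using F.smult_closed[OF fi(1) free_gen_closed[OF k fi(3)]] by simp
    have "f = (\<lambda>j. (f i \<otimes>\<^bsub>k\<^esub> free_gen k i j) \<oplus>\<^bsub>k\<^esub> g j)"
      using fi fc by (auto simp: g_def free_gen_def)
    moreover have "Q (\<lambda>j. (f i \<otimes>\<^bsub>k\<^esub> free_gen k i j) \<oplus>\<^bsub>k\<^esub> g j)"
      by (intro add e g gen fi insert.hyps(3)[OF S])
    ultimately show ?case
      by metis
  qed
qed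

lemma free_module_lift:
  assumes P: "module k P" and g: "g \<in> I \<rightarrow> carrier P"
  shows "\<exists>h \<in> lin_maps k (free_module k I) P. \<forall>i\<in>I. h (free_gen k i) = g i"
proof -
  interpret P: module k P by (rule P)
  define h where "h f = (\<Oplus>\<^bsub>P\<^esub>i\<in>{i. f i \<noteq> \<zero>\<^bsub>k\<^esub>}. f i \<odot>\<^bsub>P\<^esub> g i)" for f
  \<comment> \<open>The sum may run over any finite set between the support and \<open>I\<close>.
    Additivity depends on this, since \<open>f\<close>, \<open>f'\<close> and their sum have
    different supports.\<close>
  have h_eq: "h f = (\<Oplus>\<^bsub>P\<^esub>i\<in>S. f i \<odot>\<^bsub>P\<^esub> g i)"
    if "finite S" "S \<subseteq> I" "{i. f i \<noteq> \<zero>\<^bsub>k\<^esub>} \<subseteq> S" "f \<in> carrier (free_module k I)" for f S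
    unfolding h_def
    by (rule P.add.finprod_mono_neutral_cong_left)
      (use that g in \<open>auto simp: free_module_def Pi_iff subset_iff\<close>)
  have supp: "finite {i. f i \<noteq> \<zero>\<^bsub>k\<^esub>}" "{i. f i \<noteq> \<zero>\<^bsub>k\<^esub>} \<subseteq> I" "f i \<in> carrier k"
    if "f \<in> carrier (free_module k I)" for f i
    using that by (auto simp: free_module_def)
  interpret F: module k "free_module k I" by (rule module_free_module[OF P.is_cring])
  have "h \<in> lin_maps k (free_module k I) P"
  proof (rule lin_mapsI)
    fix f assume f: "f \<in> carrier (free_module k I)"
    show "h f \<in> carrier P"
      unfolding h_def using supp[OF f] g by (intro P.finsum_closed) auto
    fix f' assume f': "f' \<in> carrier (free_module k I)"
    let ?S = "{i. f i \<noteq> \<zero>\<^bsub>k\<^esub>} \<union> {i. f' i \<noteq> \<zero>\<^bsub>k\<^esub>}"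
    have S: "finite ?S" "?S \<subseteq> I"
      using supp[OF f] supp[OF f'] by auto
    have ff': "(\<lambda>i. f i \<oplus>\<^bsub>k\<^esub> f' i) \<in> carrier (free_module k I)"
      using F.a_closed[OF f f'] by simp
    have "h (f \<oplus>\<^bsub>free_module k I\<^esub> f') = (\<Oplus>\<^bsub>P\<^esub>i\<in>?S. (f i \<oplus>\<^bsub>k\<^esub> f' i) \<odot>\<^bsub>P\<^esub> g i)"
      by (simp, rule h_eq[OF S _ ff']) auto
    also have "\<dots> = (\<Oplus>\<^bsub>P\<^esub>i\<in>?S. f i \<odot>\<^bsub>P\<^esub> g i \<oplus>\<^bsub>P\<^esub> f' i \<odot>\<^bsub>P\<^esub> g i)"
      by (rule P.finsum_cong') (use S supp[OF f] supp[OF f'] g in \<open>auto simp: P.smult_l_distr Pi_iff subset_iff\<close>)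
    also have "\<dots> = (\<Oplus>\<^bsub>P\<^esub>i\<in>?S. f i \<odot>\<^bsub>P\<^esub> g i) \<oplus>\<^bsub>P\<^esub> (\<Oplus>\<^bsub>P\<^esub>i\<in>?S. f' i \<odot>\<^bsub>P\<^esub> g i)"
      by (rule P.finsum_addf) (use S supp[OF f] supp[OF f'] g in \<open>auto simp: Pi_iff subset_iff\<close>)
    also have "\<dots> = h f \<oplus>\<^bsub>P\<^esub> h f'"
      using h_eq[OF S _ f] h_eq[OF S _ f'] by auto
    finally show "h (f \<oplus>\<^bsub>free_module k I\<^esub> f') = h f \<oplus>\<^bsub>P\<^esub> h f'" .
  next
    fix r f assume r: "r \<in> carrier k" and f: "f \<in> carrier (free_module k I)"
    have rf: "(\<lambda>i. r \<otimes>\<^bsub>k\<^esub> f i) \<in> carrier (free_module k I)"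
      using F.smult_closed[OF r f] by simp
    have "h (r \<odot>\<^bsub>free_module k I\<^esub> f) = (\<Oplus>\<^bsub>P\<^esub>i\<in>{i. f i \<noteq> \<zero>\<^bsub>k\<^esub>}. (r \<otimes>\<^bsub>k\<^esub> f i) \<odot>\<^bsub>P\<^esub> g i)"
      by (simp, rule h_eq[OF supp(1,2)[OF f] _ rf]) (use r in auto)
    also have "\<dots> = (\<Oplus>\<^bsub>P\<^esub>i\<in>{i. f i \<noteq> \<zero>\<^bsub>k\<^esub>}. r \<odot>\<^bsub>P\<^esub> (f i \<odot>\<^bsub>P\<^esub> g i))"
      by (rule P.finsum_cong') (use r supp[OF f] g in \<open>auto simp: P.smult_assoc1 Pi_iff subset_iff\<close>)
    also have "\<dots> = r \<odot>\<^bsub>P\<^esub> h f"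
      unfolding h_def
      by (rule P.finsum_smult_ldistr[symmetric]) (use r supp[OF f] g in \<open>auto simp: Pi_iff subset_iff\<close>)
    finally show "h (r \<odot>\<^bsub>free_module k I\<^esub> f) = r \<odot>\<^bsub>P\<^esub> h f" .
  qed
  moreover have "h (free_gen k i) = g i" if "i \<in> I" for i
  proof -
    \<comment> \<open>The sum is taken over \<open>{i}\<close> and not over the support, which is
      empty when \<open>k\<close> is the zero ring.\<close>
    have "h (free_gen k i) = (\<Oplus>\<^bsub>P\<^esub>j\<in>{i}. free_gen k i j \<odot>\<^bsub>P\<^esub> g j)"
      by (rule h_eq) (use that free_gen_closed[OF P.is_cring that] in \<open>auto simp: free_gen_def\<close>)
    also have "\<dots> = g i"
      using that g by (simp add: free_gen_def Pi_iff)
    finally show ?thesis .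
  qed
  ultimately show ?thesis
    by blast
qed

section \<open>Tensor products\<close>

definition bilinear_maps ::
  "('k, 'r) ring_scheme \<Rightarrow> ('k, 'm, 's) module_scheme \<Rightarrow> ('k, 'n, 't) module_scheme \<Rightarrow>
   ('k, 'p, 'u) module_scheme \<Rightarrow> ('m \<Rightarrow> 'n \<Rightarrow> 'p) set"
  where "bilinear_maps k M N P = {B. (\<forall>m\<in>carrier M. B m \<in> lin_maps k N P) \<and>
    (\<forall>n\<in>carrier N. (\<lambda>m. B m n) \<in> lin_maps k M P)}"

lemma bilinear_mapsI:
  assumes "\<And>m. m \<in> carrier M \<Longrightarrow> B m \<in> lin_maps k N P"
    and "\<And>n. n \<in> carrier N \<Longrightarrow> (\<lambda>m. B m n) \<in> lin_maps k M P"
  shows "B \<in> bilinear_maps k M N P"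
  using assms by (simp add: bilinear_maps_def)

lemma bilinear_mapsD:
  assumes "B \<in> bilinear_maps k M N P"
  shows "m \<in> carrier M \<Longrightarrow> B m \<in> lin_maps k N P"
    and "n \<in> carrier N \<Longrightarrow> (\<lambda>m. B m n) \<in> lin_maps k M P"
  using assms by (auto simp: bilinear_maps_def)

section \<open>Construction and universal property of the tensor product\<close>

context
  fixes k :: "('k, 'r) ring_scheme" and M :: "('k, 'm, 's) module_scheme"
    and N :: "('k, 'n, 't) module_scheme"
  assumes M: "module k M" and N: "module k N"
begin

interpretation M: module k M by (rule M)
interpretation N: module k N by (rule N)
interpretation F: module k "free_module k (carrier M \<times> carrier N)"
  by (rule module_free_module[OF M.is_cring])

lemma tensor_relators_subset:
  "tensor_relators k M N \<subseteq> carrier (free_module k (carrier M \<times> carrier N))"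
  unfolding tensor_relators_def Let_def
  by (intro Un_least subsetI; elim CollectE exE conjE; hypsubst;
      intro F.minus_closed F.a_closed F.smult_closed free_gen_closed M.is_cring; simp)

lemma submodule_tensor_kernel:
  "submodule (tensor_kernel k M N) k (free_module k (carrier M \<times> carrier N))"
proof -
  \<comment> \<open>The whole free module belongs to the family being intersected. Without such a
    member the intersection would be \<open>UNIV\<close> instead of a subset of the carrier.\<close>
  have "carrier (free_module k (carrier M \<times> carrier N)) \<in> {H. submodule H k (free_module k (carrier M \<times> carrier N)) \<and> tensor_relators k M N \<subseteq> H}"
    using F.carrier_is_submodule tensor_relators_subset by simp
  then show ?thesis
    unfolding tensor_kernel_def
    by (intro F.submoduleI)
      (auto dest: F.submoduleE intro: F.submoduleE(3-5)
        subgroup.one_closed[OF submodule.axioms(1), simplified, unfolded free_module_simps]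
        simp del: free_module_simps)
qed

lemma tensor_relators_subset_kernel: "tensor_relators k M N \<subseteq> tensor_kernel k M N"
  unfolding tensor_kernel_def by blast

lemma module_tensor_module: "module k (tensor_module k M N)"
  unfolding tensor_module_def
  by (rule module_quotient_module[OF F.module_axioms submodule_tensor_kernel])

lemmas tensor_coset_eq_iff = coset_eq_iff[OF F.module_axioms submodule_tensor_kernel]

text \<open>Each of the four laws is one family of relators: the difference of its two sides,
  written in the free module, lies in the kernel, so by \<open>tensor_coset_eq_iff\<close> the
  cosets agree.\<close>

lemma pure_tensor_bilinear: "pure_tensor k M N \<in> bilinear_maps k M N (tensor_module k M N)"
proof -
  let ?F = "free_module k (carrier M \<times> carrier N)"
  let ?K = "tensor_kernel k M N"
  note gen = free_gen_closed[OF M.is_cring]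
  note Q = quotient_module_carrier[OF F.module_axioms submodule_tensor_kernel]
    quotient_module_add[OF F.module_axioms submodule_tensor_kernel]
    quotient_module_smult[OF F.module_axioms submodule_tensor_kernel]
  have closed: "pure_tensor k M N m n \<in> carrier (tensor_module k M N)"
    if "m \<in> carrier M" "n \<in> carrier N" for m n
    using that by (auto simp: pure_tensor_def tensor_module_def Q gen)
  have "pure_tensor k M N (m \<oplus>\<^bsub>M\<^esub> m') n = pure_tensor k M N m n \<oplus>\<^bsub>tensor_module k M N\<^esub> pure_tensor k M N m' n"
    if "m \<in> carrier M" "m' \<in> carrier M" "n \<in> carrier N" for m m' n
  proof -
    have "free_gen k (m \<oplus>\<^bsub>M\<^esub> m', n) \<ominus>\<^bsub>?F\<^esub> (free_gen k (m, n) \<oplus>\<^bsub>?F\<^esub> free_gen k (m', n)) \<in> tensor_relators k M N"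
      unfolding tensor_relators_def Let_def using that by blast
    then show ?thesis
      using that tensor_relators_subset_kernel unfolding pure_tensor_def tensor_module_def
      by (subst Q(2)) (simp_all add: tensor_coset_eq_iff gen subset_iff del: free_module_simps)
  qed
  moreover have "pure_tensor k M N m (n \<oplus>\<^bsub>N\<^esub> n') = pure_tensor k M N m n \<oplus>\<^bsub>tensor_module k M N\<^esub> pure_tensor k M N m n'"
    if "m \<in> carrier M" "n \<in> carrier N" "n' \<in> carrier N" for m n n'
  proof -
    have "free_gen k (m, n \<oplus>\<^bsub>N\<^esub> n') \<ominus>\<^bsub>?F\<^esub> (free_gen k (m, n) \<oplus>\<^bsub>?F\<^esub> free_gen k (m, n')) \<in> tensor_relators k M N"
      unfolding tensor_relators_def Let_def using that by blast
    then show ?thesis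
      using that tensor_relators_subset_kernel unfolding pure_tensor_def tensor_module_def
      by (subst Q(2)) (simp_all add: tensor_coset_eq_iff gen subset_iff del: free_module_simps)
  qed
  moreover have "pure_tensor k M N (r \<odot>\<^bsub>M\<^esub> m) n = r \<odot>\<^bsub>tensor_module k M N\<^esub> pure_tensor k M N m n"
    if "r \<in> carrier k" "m \<in> carrier M" "n \<in> carrier N" for r m n
  proof -
    have "free_gen k (r \<odot>\<^bsub>M\<^esub> m, n) \<ominus>\<^bsub>?F\<^esub> r \<odot>\<^bsub>?F\<^esub> free_gen k (m, n) \<in> tensor_relators k M N"
      unfolding tensor_relators_def Let_def using that by blast
    then show ?thesis
      using that tensor_relators_subset_kernel unfolding pure_tensor_def tensor_module_def
      by (subst Q(3)) (simp_all add: tensor_coset_eq_iff gen subset_iff del: free_module_simps)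
  qed
  moreover have "pure_tensor k M N m (r \<odot>\<^bsub>N\<^esub> n) = r \<odot>\<^bsub>tensor_module k M N\<^esub> pure_tensor k M N m n"
    if "r \<in> carrier k" "m \<in> carrier M" "n \<in> carrier N" for r m n
  proof -
    have "free_gen k (m, r \<odot>\<^bsub>N\<^esub> n) \<ominus>\<^bsub>?F\<^esub> r \<odot>\<^bsub>?F\<^esub> free_gen k (m, n) \<in> tensor_relators k M N"
      unfolding tensor_relators_def Let_def using that by blast
    then show ?thesis
      using that tensor_relators_subset_kernel unfolding pure_tensor_def tensor_module_def
      by (subst Q(3)) (simp_all add: tensor_coset_eq_iff gen subset_iff del: free_module_simps)
  qed
  ultimately show ?thesis
    by (intro bilinear_mapsI lin_mapsI closed)
qed

lemmas pure_tensor_closed = lin_maps_closed[OF bilinear_mapsD(1)[OF pure_tensor_bilinear]]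

text \<open>Pure tensors generate already under addition: a scalar multiple of a pure tensor is pure
  by bilinearity, and zero is the pure tensor of two zeros.\<close>

lemma tensor_induct [consumes 1, case_names pure add]:
  assumes t: "t \<in> carrier (tensor_module k M N)"
    and pure: "\<And>m n. m \<in> carrier M \<Longrightarrow> n \<in> carrier N \<Longrightarrow> Q (pure_tensor k M N m n)"
    and add: "\<And>s t. s \<in> carrier (tensor_module k M N) \<Longrightarrow> t \<in> carrier (tensor_module k M N) \<Longrightarrow>
      Q s \<Longrightarrow> Q t \<Longrightarrow> Q (s \<oplus>\<^bsub>tensor_module k M N\<^esub> t)"
  shows "Q t"
proof -
  let ?F = "free_module k (carrier M \<times> carrier N)"
  let ?K = "tensor_kernel k M N"
  note S = quotient_module_carrier[OF F.module_axioms submodule_tensor_kernel, folded tensor_module_def]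
    quotient_module_add[OF F.module_axioms submodule_tensor_kernel, folded tensor_module_def]
    quotient_module_smult[OF F.module_axioms submodule_tensor_kernel, folded tensor_module_def]
    quotient_module_zero[OF F.module_axioms submodule_tensor_kernel, folded tensor_module_def]
  have Q_gen: "Q (?K +>\<^bsub>?F\<^esub> (\<lambda>j. r \<otimes>\<^bsub>k\<^esub> free_gen k (m, n) j))"
    if r: "r \<in> carrier k" and mn: "m \<in> carrier M" "n \<in> carrier N" for r m n
  proof -
    have "?K +>\<^bsub>?F\<^esub> (\<lambda>j. r \<otimes>\<^bsub>k\<^esub> free_gen k (m, n) j) = r \<odot>\<^bsub>tensor_module k M N\<^esub> pure_tensor k M N m n"
      unfolding pure_tensor_def using r mn by (simp add: S(3) free_gen_closed[OF M.is_cring])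
    also have "\<dots> = pure_tensor k M N (r \<odot>\<^bsub>M\<^esub> m) n"
      using lin_maps_smult[OF bilinear_mapsD(2)[OF pure_tensor_bilinear mn(2)] r mn(1)] by simp
    finally show ?thesis
      using r mn pure by simp
  qed
  have Q_zero: "Q (?K +>\<^bsub>?F\<^esub> (\<lambda>j. \<zero>\<^bsub>k\<^esub>))"
  proof -
    have "pure_tensor k M N \<zero>\<^bsub>M\<^esub> \<zero>\<^bsub>N\<^esub> = \<zero>\<^bsub>tensor_module k M N\<^esub>"
      by (rule lin_maps_zero[OF N module_tensor_module bilinear_mapsD(1)[OF pure_tensor_bilinear]]) simp
    then show ?thesis
      using pure[of "\<zero>\<^bsub>M\<^esub>" "\<zero>\<^bsub>N\<^esub>"] by (simp add: S(4))
  qed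
  obtain f where f: "f \<in> carrier ?F" "t = ?K +>\<^bsub>?F\<^esub> f"
    using t by (auto simp: S(1))
  have "Q (?K +>\<^bsub>?F\<^esub> f)"
    using M.is_cring f(1)
  proof (induction rule: free_module_induct)
    case zero
    show ?case by (rule Q_zero)
  next
    case (gen r i)
    then show ?case using Q_gen by auto
  next
    case (add f g)
    then have "Q ((?K +>\<^bsub>?F\<^esub> f) \<oplus>\<^bsub>tensor_module k M N\<^esub> (?K +>\<^bsub>?F\<^esub> g))"
      by (intro assms(3)) (auto simp: S(1))
    then show ?case
      using add by (simp add: S(2))
  qed
  then show ?thesis
    by (simp add: f(2))
qed

lemma tensor_module_lin_maps_eqI:
  assumes P: "module k P" and "f \<in> lin_maps k (tensor_module k M N) P" "g \<in> lin_maps k (tensor_module k M N) P"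
    and "\<And>m n. m \<in> carrier M \<Longrightarrow> n \<in> carrier N \<Longrightarrow>
      f (pure_tensor k M N m n) = g (pure_tensor k M N m n)"
    and "t \<in> carrier (tensor_module k M N)"
  shows "f t = g t"
  using assms(5)
proof (induction rule: tensor_induct)
  case (add s t)
  then show ?case
    using lin_maps_add[OF assms(2)] lin_maps_add[OF assms(3)] by simp
qed (rule assms(4))

text \<open>The universal property. The linear extension \<open>E\<close> of \<open>B\<close> to the
  free module has a submodule as kernel. By bilinearity of \<open>B\<close> this kernel contains
  every relator, hence \<open>tensor_kernel\<close>, so \<open>E\<close> descends to the quotient.
  Uniqueness holds because pure tensors generate and the maps are extensional.\<close>

lemma tensor_lift_unique_exists:
  assumes P: "module k P" and B: "B \<in> bilinear_maps k M N P"
  shows "\<exists>!h. h \<in> lin_maps k (tensor_module k M N) P \<and> h \<in> extensional (carrier (tensor_module k M N)) \<and>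
    (\<forall>m\<in>carrier M. \<forall>n\<in>carrier N. h (pure_tensor k M N m n) = B m n)"
proof -
  interpret P: module k P by (rule P)
  let ?F = "free_module k (carrier M \<times> carrier N)"
  have Bc: "B m n \<in> carrier P" if "m \<in> carrier M" "n \<in> carrier N" for m n
    using lin_maps_closed[OF bilinear_mapsD(1)[OF B that(1)] that(2)] .
  obtain E where E: "E \<in> lin_maps k ?F P"
    and E_gen: "\<And>m n. m \<in> carrier M \<Longrightarrow> n \<in> carrier N \<Longrightarrow> E (free_gen k (m, n)) = B m n"
    using free_module_lift[OF P, of "case_prod B" "carrier M \<times> carrier N"] Bc by force
  define H where "H = {x \<in> carrier ?F. E x = \<zero>\<^bsub>P\<^esub>}"
  have "submodule H k ?F"
    by (rule F.submoduleI)
      (auto simp: H_def lin_maps_zero[OF F.module_axioms P E] lin_maps_a_inv[OF F.module_axioms P E]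
        lin_maps_add[OF E] lin_maps_smult[OF E] simp del: free_module_simps)
  moreover have "tensor_relators k M N \<subseteq> H"
  proof -
    have diff: "x \<ominus>\<^bsub>?F\<^esub> y \<in> H" if "x \<in> carrier ?F" "y \<in> carrier ?F" "E x = E y" for x y
      using that lin_maps_closed[OF E that(2)]
      by (simp add: H_def lin_maps_a_minus[OF F.module_axioms P E] P.minus_eq P.r_neg)
    note gen = free_gen_closed[OF M.is_cring]
    note B1 = bilinear_mapsD(1)[OF B] and B2 = bilinear_mapsD(2)[OF B]
    show ?thesis
      unfolding tensor_relators_def Let_def
    proof (intro Un_least subsetI; elim CollectE exE conjE; hypsubst)
      fix m m' n assume a: "m \<in> carrier M" "m' \<in> carrier M" "n \<in> carrier N"
      show "free_gen k (m \<oplus>\<^bsub>M\<^esub> m', n) \<ominus>\<^bsub>?F\<^esub> (free_gen k (m, n) \<oplus>\<^bsub>?F\<^esub> free_gen k (m', n)) \<in> H"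
        by (rule diff) (use a lin_maps_add[OF B2] in
          \<open>simp_all add: gen lin_maps_add[OF E] E_gen del: free_module_simps\<close>)
    next
      fix m n n' assume a: "m \<in> carrier M" "n \<in> carrier N" "n' \<in> carrier N"
      show "free_gen k (m, n \<oplus>\<^bsub>N\<^esub> n') \<ominus>\<^bsub>?F\<^esub> (free_gen k (m, n) \<oplus>\<^bsub>?F\<^esub> free_gen k (m, n')) \<in> H"
        by (rule diff) (use a lin_maps_add[OF B1] in
          \<open>simp_all add: gen lin_maps_add[OF E] E_gen del: free_module_simps\<close>)
    next
      fix r m n assume a: "r \<in> carrier k" "m \<in> carrier M" "n \<in> carrier N"
      show "free_gen k (r \<odot>\<^bsub>M\<^esub> m, n) \<ominus>\<^bsub>?F\<^esub> r \<odot>\<^bsub>?F\<^esub> free_gen k (m, n) \<in> H"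
        by (rule diff) (use a lin_maps_smult[OF B2] in
          \<open>simp_all add: gen lin_maps_smult[OF E] E_gen del: free_module_simps\<close>)
    next
      fix r m n assume a: "r \<in> carrier k" "m \<in> carrier M" "n \<in> carrier N"
      show "free_gen k (m, r \<odot>\<^bsub>N\<^esub> n) \<ominus>\<^bsub>?F\<^esub> r \<odot>\<^bsub>?F\<^esub> free_gen k (m, n) \<in> H"
        by (rule diff) (use a lin_maps_smult[OF B1] in
          \<open>simp_all add: gen lin_maps_smult[OF E] E_gen del: free_module_simps\<close>)
    qed
  qed
  ultimately have "tensor_kernel k M N \<subseteq> H"
    unfolding tensor_kernel_def by blast
  then obtain h where h: "h \<in> lin_maps k (tensor_module k M N) P"
    and h_eq: "\<And>x. x \<in> carrier ?F \<Longrightarrow> h (tensor_kernel k M N +>\<^bsub>?F\<^esub> x) = E x"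
    using quotient_module_lift[OF F.module_axioms submodule_tensor_kernel P E]
    unfolding tensor_module_def H_def by blast
  show ?thesis
  proof (rule ex1I)
    \<comment> \<open>The descended map is unconstrained off the carrier; restricting it gives the
      extensional representative that \<open>tensor_lift\<close> singles out.\<close>
    let ?h = "restrict h (carrier (tensor_module k M N))"
    have lin: "?h \<in> lin_maps k (tensor_module k M N) P"
      by (rule restrict_lin_maps[OF module_tensor_module h])
    have pure: "?h (pure_tensor k M N m n) = B m n" if "m \<in> carrier M" "n \<in> carrier N" for m n
    proof -
      have "?h (pure_tensor k M N m n) = h (pure_tensor k M N m n)"
        using that by (simp add: pure_tensor_closed)
      also have "\<dots> = B m n"
        using that by (simp add: pure_tensor_def h_eq E_gen free_gen_closed[OF M.is_cring])
      finally show ?thesis .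
    qed
    show "?h \<in> lin_maps k (tensor_module k M N) P \<and> ?h \<in> extensional (carrier (tensor_module k M N)) \<and>
      (\<forall>m\<in>carrier M. \<forall>n\<in>carrier N. ?h (pure_tensor k M N m n) = B m n)"
      using lin pure by blast
    fix g assume g: "g \<in> lin_maps k (tensor_module k M N) P \<and> g \<in> extensional (carrier (tensor_module k M N)) \<and>
      (\<forall>m\<in>carrier M. \<forall>n\<in>carrier N. g (pure_tensor k M N m n) = B m n)"
    show "g = ?h"
    proof (rule extensionalityI)
      fix t assume t: "t \<in> carrier (tensor_module k M N)"
      show "g t = ?h t"
        by (rule tensor_module_lin_maps_eqI[OF P _ lin _ t]) (use g pure in \<open>auto\<close>)
    qed (use g in auto)
  qed
qed

context
  fixes P :: "('k, 'p, 'u) module_scheme" and B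
  assumes P: "module k P" and B: "B \<in> bilinear_maps k M N P"
begin

lemma tensor_lift_lin: "tensor_lift k M N P B \<in> lin_maps k (tensor_module k M N) P"
  and tensor_lift_pure: "m \<in> carrier M \<Longrightarrow> n \<in> carrier N \<Longrightarrow>
    tensor_lift k M N P B (pure_tensor k M N m n) = B m n"
  using theI'[OF tensor_lift_unique_exists[OF P B]] unfolding tensor_lift_def by blast+

text \<open>The conclusion is pointwise on the carrier, so that a lift can be compared directly with
  a composite of linear maps, which is rarely extensional.\<close>

lemma tensor_lift_unique:
  assumes "f \<in> lin_maps k (tensor_module k M N) P"
    and "\<And>m n. m \<in> carrier M \<Longrightarrow> n \<in> carrier N \<Longrightarrow> f (pure_tensor k M N m n) = B m n"
    and "t \<in> carrier (tensor_module k M N)"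
  shows "tensor_lift k M N P B t = f t"
  using tensor_module_lin_maps_eqI[OF P tensor_lift_lin assms(1) _ assms(3)] tensor_lift_pure assms(2) by simp

end

end

section \<open>Functoriality and the calculus of Sweedler expressions\<close>

lemma tensor_map_bilinear:
  assumes "module k P" "module k Q" "f \<in> lin_maps k M P" "g \<in> lin_maps k N Q"
  shows "(\<lambda>m n. pure_tensor k P Q (f m) (g n)) \<in> bilinear_maps k M N (tensor_module k P Q)"
proof (rule bilinear_mapsI)
  note pb = bilinear_mapsD[OF pure_tensor_bilinear[OF assms(1,2)]]
  show "(\<lambda>n. pure_tensor k P Q (f m) (g n)) \<in> lin_maps k N (tensor_module k P Q)" if "m \<in> carrier M" for m
    using lin_maps_compose[OF assms(4) pb(1)] lin_maps_closed[OF assms(3) that] .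
  show "(\<lambda>m. pure_tensor k P Q (f m) (g n)) \<in> lin_maps k M (tensor_module k P Q)" if "n \<in> carrier N" for n
    using lin_maps_compose[OF assms(3) pb(2)] lin_maps_closed[OF assms(4) that] .
qed

lemma tensor_map_lin:
  assumes "module k M" "module k N" "module k P" "module k Q" "f \<in> lin_maps k M P" "g \<in> lin_maps k N Q"
  shows "tensor_map k M N P Q f g \<in> lin_maps k (tensor_module k M N) (tensor_module k P Q)"
  unfolding tensor_map_def
  by (intro tensor_lift_lin assms module_tensor_module tensor_map_bilinear)

lemma tensor_map_pure:
  assumes "module k M" "module k N" "module k P" "module k Q" "f \<in> lin_maps k M P" "g \<in> lin_maps k N Q"
    and "m \<in> carrier M" "n \<in> carrier N"
  shows "tensor_map k M N P Q f g (pure_tensor k M N m n) = pure_tensor k P Q (f m) (g n)"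
  unfolding tensor_map_def
  by (intro tensor_lift_pure assms module_tensor_module tensor_map_bilinear)

text \<open>The substitution rule for Sweedler expressions. Both sides are linear in
  \<open>t\<close> and agree on pure tensors.\<close>

lemma tensor_lift_tensor_map:
  assumes M: "module k M" and N: "module k N" and P: "module k P" and Q: "module k Q" and R: "module k R"
    and f: "f \<in> lin_maps k M P" and g: "g \<in> lin_maps k N Q" and B: "B \<in> bilinear_maps k P Q R"
    and t: "t \<in> carrier (tensor_module k M N)"
  shows "tensor_lift k P Q R B (tensor_map k M N P Q f g t) = tensor_lift k M N R (\<lambda>m n. B (f m) (g n)) t"
proof -
  have B': "(\<lambda>m n. B (f m) (g n)) \<in> bilinear_maps k M N R"
    by (intro bilinear_mapsI lin_maps_compose[OF f bilinear_mapsD(2)[OF B]]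
        lin_maps_compose[OF g bilinear_mapsD(1)[OF B]] lin_maps_closed[OF f] lin_maps_closed[OF g])
  show ?thesis
    by (rule tensor_lift_unique[OF M N R B' lin_maps_compose[OF tensor_map_lin[OF M N P Q f g]
        tensor_lift_lin[OF P Q R B]] _ t, symmetric])
      (simp add: tensor_map_pure[OF M N P Q f g] tensor_lift_pure[OF P Q R B]
        lin_maps_closed[OF f] lin_maps_closed[OF g])
qed

text \<open>Only the values of \<open>B\<close> on the two carriers enter the definite description,
  so the lifts coincide as functions, and an integrand may be rewritten using carrier membership of
  its variables.\<close>

lemma tensor_lift_cong:
  assumes "\<And>m n. m \<in> carrier M \<Longrightarrow> n \<in> carrier N \<Longrightarrow> B m n = B' m n"
  shows "tensor_lift k M N P B = tensor_lift k M N P B'"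
proof -
  have "(\<forall>m\<in>carrier M. \<forall>n\<in>carrier N. h (pure_tensor k M N m n) = B m n) \<longleftrightarrow>
      (\<forall>m\<in>carrier M. \<forall>n\<in>carrier N. h (pure_tensor k M N m n) = B' m n)" for h
    using assms by auto
  then show ?thesis
    by (simp add: tensor_lift_def)
qed

lemma lin_map_tensor_lift:
  assumes M: "module k M" and N: "module k N" and P: "module k P" and Q: "module k Q"
    and B: "B \<in> bilinear_maps k M N P" and f: "f \<in> lin_maps k P Q"
    and t: "t \<in> carrier (tensor_module k M N)"
  shows "f (tensor_lift k M N P B t) = tensor_lift k M N Q (\<lambda>m n. f (B m n)) t"
proof -
  have fB: "(\<lambda>m n. f (B m n)) \<in> bilinear_maps k M N Q"
    by (intro bilinear_mapsI lin_maps_compose[OF _ f] bilinear_mapsD[OF B])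
  show ?thesis
    by (rule tensor_lift_unique[OF M N Q fB lin_maps_compose[OF tensor_lift_lin[OF M N P B] f] _ t, symmetric])
      (simp add: tensor_lift_pure[OF M N P B])
qed

text \<open>This supplies the bilinearity of iterated lifts. On pure tensors linearity in
  \<open>q\<close> is the hypothesis \<open>lin\<close>, and sums of linear maps are linear. The
  equations used are valid only for \<open>q\<close> in the carrier, hence the passage through
  \<open>lin_maps_cong\<close>.\<close>

lemma tensor_lift_param_lin:
  assumes M: "module k M" and N: "module k N" and P: "module k P" and Q: "module k Q"
    and B: "\<And>q. q \<in> carrier Q \<Longrightarrow> B q \<in> bilinear_maps k M N P"
    and lin: "\<And>m n. m \<in> carrier M \<Longrightarrow> n \<in> carrier N \<Longrightarrow> (\<lambda>q. B q m n) \<in> lin_maps k Q P"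
    and t: "t \<in> carrier (tensor_module k M N)"
  shows "(\<lambda>q. tensor_lift k M N P (B q) t) \<in> lin_maps k Q P"
  using t
proof (induction rule: tensor_induct[OF M N, consumes 1, case_names pure add])
  case (pure m n)
  have eq: "tensor_lift k M N P (B q) (pure_tensor k M N m n) = B q m n" if "q \<in> carrier Q" for q
    using tensor_lift_pure[OF M N P B[OF that] pure] .
  show ?case
    by (rule lin_maps_cong[OF Q, THEN iffD2, OF eq lin[OF pure]])
next
  case (add s t)
  have eq: "tensor_lift k M N P (B q) (s \<oplus>\<^bsub>tensor_module k M N\<^esub> t) =
      tensor_lift k M N P (B q) s \<oplus>\<^bsub>P\<^esub> tensor_lift k M N P (B q) t" if "q \<in> carrier Q" for q
    using lin_maps_add[OF tensor_lift_lin[OF M N P B[OF that]] add(1,2)] .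
  show ?case
    by (rule lin_maps_cong[OF Q, THEN iffD2, OF eq lin_maps_sum[OF P add(3,4)]])
qed

text \<open>A Fubini rule for two Sweedler sums. For fixed \<open>t\<close> both sides are linear in
  \<open>s\<close>, and at a pure tensor of \<open>m\<close> and \<open>n\<close> both become the
  lift of \<open>B m n\<close> at \<open>t\<close>.\<close>

lemma tensor_lift_swap:
  assumes M: "module k M" and N: "module k N" and P: "module k P" and Q: "module k Q" and R: "module k R"
    and B1: "\<And>p q. p \<in> carrier P \<Longrightarrow> q \<in> carrier Q \<Longrightarrow> (\<lambda>m n. B m n p q) \<in> bilinear_maps k M N R"
    and B2: "\<And>m n. m \<in> carrier M \<Longrightarrow> n \<in> carrier N \<Longrightarrow> B m n \<in> bilinear_maps k P Q R"
    and s: "s \<in> carrier (tensor_module k M N)" and t: "t \<in> carrier (tensor_module k P Q)"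
  shows "tensor_lift k M N R (\<lambda>m n. tensor_lift k P Q R (B m n) t) s =
    tensor_lift k P Q R (\<lambda>p q. tensor_lift k M N R (\<lambda>m n. B m n p q) s) t"
proof -
  have outer: "(\<lambda>m n. tensor_lift k P Q R (B m n) t) \<in> bilinear_maps k M N R"
  proof (rule bilinear_mapsI)
    show "(\<lambda>n. tensor_lift k P Q R (B m n) t) \<in> lin_maps k N R" if "m \<in> carrier M" for m
      using that by (intro tensor_lift_param_lin[OF P Q R N _ _ t] B2 bilinear_mapsD(1)[OF B1])
    show "(\<lambda>m. tensor_lift k P Q R (B m n) t) \<in> lin_maps k M R" if "n \<in> carrier N" for n
      using that by (intro tensor_lift_param_lin[OF P Q R M _ _ t] B2 bilinear_mapsD(2)[OF B1])
  qed
  \<comment> \<open>Stated for every \<open>u\<close> and not just for \<open>s\<close>, because the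
    right-hand side is about to be treated as a function of the first tensor.\<close>
  have inner: "(\<lambda>p q. tensor_lift k M N R (\<lambda>m n. B m n p q) u) \<in> bilinear_maps k P Q R"
    if u: "u \<in> carrier (tensor_module k M N)" for u
  proof (rule bilinear_mapsI)
    show "(\<lambda>q. tensor_lift k M N R (\<lambda>m n. B m n p q) u) \<in> lin_maps k Q R" if "p \<in> carrier P" for p
      using that by (intro tensor_lift_param_lin[OF M N R Q _ _ u] B1 bilinear_mapsD(1)[OF B2])
    show "(\<lambda>p. tensor_lift k M N R (\<lambda>m n. B m n p q) u) \<in> lin_maps k P R" if "q \<in> carrier Q" for q
      using that by (intro tensor_lift_param_lin[OF M N R P _ _ u] B1 bilinear_mapsD(2)[OF B2])
  qed
  show ?thesis
  proof (rule tensor_lift_unique[OF M N R outer _ _ s])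
    show "(\<lambda>u. tensor_lift k P Q R (\<lambda>p q. tensor_lift k M N R (\<lambda>m n. B m n p q) u) t)
        \<in> lin_maps k (tensor_module k M N) R"
      by (intro tensor_lift_param_lin[OF P Q R module_tensor_module[OF M N] _ _ t] inner
          tensor_lift_lin[OF M N R] B1)
    show "tensor_lift k P Q R (\<lambda>p q. tensor_lift k M N R (\<lambda>m n. B m n p q) (pure_tensor k M N m n)) t =
        tensor_lift k P Q R (B m n) t" if "m \<in> carrier M" "n \<in> carrier N" for m n
      using that by (intro fun_cong[OF tensor_lift_cong] tensor_lift_pure[OF M N R] B1)
  qed
qed

section \<open>Duals of finitely generated projective modules\<close>

lemma fg_projective_module: "fg_projective k M \<Longrightarrow> module k M"
  by (simp add: fg_projective_def)

lemma lin_map_free_module_eq_finsum: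
  fixes n :: nat
  assumes M: "module k M" and p: "p \<in> lin_maps k (free_module k {..<n}) M"
    and v: "v \<in> carrier (free_module k {..<n})"
  shows "p v = (\<Oplus>\<^bsub>M\<^esub>i\<in>{..<n}. v i \<odot>\<^bsub>M\<^esub> p (free_gen k i))"
proof -
  interpret M: module k M by (rule M)
  interpret F: module k "free_module k {..<n}" by (rule module_free_module[OF M.is_cring])
  have pe: "p (free_gen k i) \<in> carrier M" if "i < n" for i
    using lin_maps_closed[OF p free_gen_closed[OF M.is_cring]] that by simp
  have val: "v i \<in> carrier k" if "v \<in> carrier (free_module k {..<n})" for v i
    using that by (simp add: free_module_def)
  show ?thesis
    using M.is_cring v
  proof (induction rule: free_module_induct)
    case zero
    have "p (\<lambda>i. \<zero>\<^bsub>k\<^esub>) = \<zero>\<^bsub>M\<^esub>"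
      using lin_maps_zero[OF F.module_axioms M p] by simp
    moreover have "(\<Oplus>\<^bsub>M\<^esub>i\<in>{..<n}. \<zero>\<^bsub>k\<^esub> \<odot>\<^bsub>M\<^esub> p (free_gen k i)) = (\<Oplus>\<^bsub>M\<^esub>i\<in>{..<n}. \<zero>\<^bsub>M\<^esub>)"
      by (rule M.finsum_cong') (use pe in auto)
    ultimately show ?case
      by simp
  next
    case (gen r j)
    have "p (\<lambda>i. r \<otimes>\<^bsub>k\<^esub> free_gen k j i) = r \<odot>\<^bsub>M\<^esub> p (free_gen k j)"
      using lin_maps_smult[OF p gen(1) free_gen_closed[OF M.is_cring gen(2)]] by simp
    also have "\<dots> = (\<Oplus>\<^bsub>M\<^esub>i\<in>{..<n}. if j = i then r \<odot>\<^bsub>M\<^esub> p (free_gen k i) else \<zero>\<^bsub>M\<^esub>)"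
      by (rule M.finsum_singleton[symmetric]) (use gen pe in auto)
    also have "\<dots> = (\<Oplus>\<^bsub>M\<^esub>i\<in>{..<n}. (r \<otimes>\<^bsub>k\<^esub> free_gen k j i) \<odot>\<^bsub>M\<^esub> p (free_gen k i))"
      by (rule M.finsum_cong') (use gen pe in \<open>auto simp: free_gen_def\<close>)
    finally show ?case .
  next
    case (add f g)
    have "p (\<lambda>i. f i \<oplus>\<^bsub>k\<^esub> g i) = p f \<oplus>\<^bsub>M\<^esub> p g"
      using lin_maps_add[OF p add(1,2)] by simp
    also have "\<dots> = (\<Oplus>\<^bsub>M\<^esub>i\<in>{..<n}. f i \<odot>\<^bsub>M\<^esub> p (free_gen k i) \<oplus>\<^bsub>M\<^esub> g i \<odot>\<^bsub>M\<^esub> p (free_gen k i))"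
      unfolding add(3,4) by (rule M.finsum_addf[symmetric]) (use pe val[OF add(1)] val[OF add(2)] in auto)
    also have "\<dots> = (\<Oplus>\<^bsub>M\<^esub>i\<in>{..<n}. (f i \<oplus>\<^bsub>k\<^esub> g i) \<odot>\<^bsub>M\<^esub> p (free_gen k i))"
      by (rule M.finsum_cong') (use pe val[OF add(1)] val[OF add(2)] in \<open>auto simp: M.smult_l_distr\<close>)
    finally show ?case .
  qed
qed

text \<open>Expanding \<open>\<iota> m\<close> in the standard basis of the free module and applying
  \<open>\<pi>\<close> gives back \<open>m\<close>. The generators are the images of the basis
  vectors under \<open>\<pi>\<close>, and the forms are the components of
  \<open>\<iota>\<close>.\<close>

lemma fg_projective_finite_generation:
  assumes "fg_projective k M"
  obtains n :: nat and e f where "e \<in> {..<n} \<rightarrow> carrier M"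
    and "\<And>i. i < n \<Longrightarrow> f i \<in> lin_maps k M (regular_module k)"
    and "\<And>m. m \<in> carrier M \<Longrightarrow> (\<Oplus>\<^bsub>M\<^esub>i\<in>{..<n}. f i m \<odot>\<^bsub>M\<^esub> e i) = m"
proof -
  obtain n :: nat and \<iota> \<pi> where M: "module k M" and \<iota>: "\<iota> \<in> lin_maps k M (free_module k {..<n})"
    and \<pi>: "\<pi> \<in> lin_maps k (free_module k {..<n}) M" and inv: "\<And>m. m \<in> carrier M \<Longrightarrow> \<pi> (\<iota> m) = m"
    using assms unfolding fg_projective_def by blast
  interpret M: module k M by (rule M)
  show ?thesis
  proof (rule that[of "\<lambda>i. \<pi> (free_gen k i)" n "\<lambda>i m. \<iota> m i"])
    show "(\<lambda>i. \<pi> (free_gen k i)) \<in> {..<n} \<rightarrow> carrier M"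
      using lin_maps_closed[OF \<pi> free_gen_closed[OF M.is_cring]] by simp
    show "(\<lambda>m. \<iota> m i) \<in> lin_maps k M (regular_module k)" for i
      by (rule lin_mapsI)
        (use lin_maps_closed[OF \<iota>] in \<open>simp_all add: lin_maps_add[OF \<iota>] lin_maps_smult[OF \<iota>], simp add: free_module_def\<close>)
    show "(\<Oplus>\<^bsub>M\<^esub>i\<in>{..<n}. \<iota> m i \<odot>\<^bsub>M\<^esub> \<pi> (free_gen k i)) = m" if "m \<in> carrier M" for m
      using lin_map_free_module_eq_finsum[OF M \<pi> lin_maps_closed[OF \<iota> that]] inv[OF that] by simp
  qed
qed

section \<open>The dual as a module with pointwise operations\<close>

lemma dual_algebra_simps:
  "carrier (dual_algebra k M) = lin_maps k M (regular_module k) \<inter> extensional (carrier M)"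
  "\<zero>\<^bsub>dual_algebra k M\<^esub> = (\<lambda>a\<in>carrier M. \<zero>\<^bsub>k\<^esub>)"
  "c \<oplus>\<^bsub>dual_algebra k M\<^esub> d = (\<lambda>a\<in>carrier M. c a \<oplus>\<^bsub>k\<^esub> d a)"
  "r \<odot>\<^bsub>dual_algebra k M\<^esub> c = (\<lambda>a\<in>carrier M. r \<otimes>\<^bsub>k\<^esub> c a)"
  by (simp_all add: dual_algebra_def)

lemma dual_algebra_apply:
  assumes "a \<in> carrier M"
  shows "\<zero>\<^bsub>dual_algebra k M\<^esub> a = \<zero>\<^bsub>k\<^esub>"
    and "(c \<oplus>\<^bsub>dual_algebra k M\<^esub> d) a = c a \<oplus>\<^bsub>k\<^esub> d a"
    and "(r \<odot>\<^bsub>dual_algebra k M\<^esub> c) a = r \<otimes>\<^bsub>k\<^esub> c a"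
  using assms by (simp_all add: dual_algebra_simps)

lemma dual_algebraD:
  assumes "c \<in> carrier (dual_algebra k M)"
  shows "c \<in> lin_maps k M (regular_module k)"
    and "a \<in> carrier M \<Longrightarrow> c a \<in> carrier k"
  using assms lin_maps_closed[of c k M "regular_module k" a] by (simp_all add: dual_algebra_simps)

lemma dual_algebra_eqI:
  assumes "c \<in> carrier (dual_algebra k M)" "d \<in> carrier (dual_algebra k M)"
    and "\<And>a. a \<in> carrier M \<Longrightarrow> c a = d a"
  shows "c = d"
  using assms by (intro extensionalityI[of c "carrier M"]) (simp_all add: dual_algebra_simps)

lemma dual_algebraI:
  assumes "module k M" "f \<in> lin_maps k M (regular_module k)"
  shows "restrict f (carrier M) \<in> carrier (dual_algebra k M)"
  using restrict_lin_maps[OF assms] by (simp add: dual_algebra_simps)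

lemma eval_dual_algebra_lin:
  assumes "a \<in> carrier M"
  shows "(\<lambda>c. c a) \<in> lin_maps k (dual_algebra k M) (regular_module k)"
  by (rule lin_mapsI) (use assms dual_algebraD(2) in \<open>fastforce simp: dual_algebra_simps\<close>)+

lemma module_dual_algebra:
  assumes M: "module k M"
  shows "module k (dual_algebra k M)"
proof -
  interpret M: module k M by (rule M)
  let ?D = "dual_algebra k M"
  have val: "c a \<in> carrier k" if "c \<in> carrier ?D" "a \<in> carrier M" for c a
    using that by (rule dual_algebraD)
  note add = lin_maps_add[OF dual_algebraD(1), simplified]
  note smult = lin_maps_smult[OF dual_algebraD(1), simplified]
  have zero: "\<zero>\<^bsub>?D\<^esub> \<in> carrier ?D"
    unfolding dual_algebra_simps(2) by (rule dual_algebraI[OF M], rule lin_mapsI) simp_all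
  have closed_add: "c \<oplus>\<^bsub>?D\<^esub> d \<in> carrier ?D" if "c \<in> carrier ?D" "d \<in> carrier ?D" for c d
    unfolding dual_algebra_simps(3)
    by (rule dual_algebraI[OF M], rule lin_mapsI)
      (use that val in \<open>simp_all add: add[OF that(1)] add[OF that(2)] smult[OF that(1)] smult[OF that(2)] M.R.a_ac M.R.r_distr\<close>)
  have closed_smult: "r \<odot>\<^bsub>?D\<^esub> c \<in> carrier ?D" if "r \<in> carrier k" "c \<in> carrier ?D" for r c
    unfolding dual_algebra_simps(4)
    by (rule dual_algebraI[OF M], rule lin_mapsI)
      (use that val in \<open>simp_all add: add[OF that(2)] smult[OF that(2)] M.m_lcomm M.R.r_distr\<close>)
  note closed = zero closed_add closed_smult
  show ?thesis
  proof (rule moduleI)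
    show "abelian_group ?D"
    proof (rule abelian_groupI)
      fix c assume c: "c \<in> carrier ?D"
      have "(\<ominus>\<^bsub>k\<^esub> \<one>\<^bsub>k\<^esub>) \<odot>\<^bsub>?D\<^esub> c \<oplus>\<^bsub>?D\<^esub> c = \<zero>\<^bsub>?D\<^esub>"
        by (rule dual_algebra_eqI[of _ k M])
          (use c in \<open>simp_all add: closed dual_algebra_apply val M.R.l_minus M.R.l_neg\<close>)
      then show "\<exists>d\<in>carrier ?D. d \<oplus>\<^bsub>?D\<^esub> c = \<zero>\<^bsub>?D\<^esub>"
        using closed_smult[OF _ c] by blast
    next
      fix b c d assume b: "b \<in> carrier ?D" and c: "c \<in> carrier ?D" and d: "d \<in> carrier ?D"
      show "b \<oplus>\<^bsub>?D\<^esub> c \<oplus>\<^bsub>?D\<^esub> d = b \<oplus>\<^bsub>?D\<^esub> (c \<oplus>\<^bsub>?D\<^esub> d)"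
        by (rule dual_algebra_eqI[of _ k M]) (use b c d in \<open>simp_all add: closed dual_algebra_apply val M.R.a_assoc\<close>)
    next
      fix b c assume b: "b \<in> carrier ?D" and c: "c \<in> carrier ?D"
      show "b \<oplus>\<^bsub>?D\<^esub> c = c \<oplus>\<^bsub>?D\<^esub> b"
        by (rule dual_algebra_eqI[of _ k M]) (use b c in \<open>simp_all add: closed dual_algebra_apply val M.R.a_comm\<close>)
    next
      fix c assume c: "c \<in> carrier ?D"
      show "\<zero>\<^bsub>?D\<^esub> \<oplus>\<^bsub>?D\<^esub> c = c"
        by (rule dual_algebra_eqI[of _ k M]) (use c in \<open>simp_all add: closed dual_algebra_apply val\<close>)
    qed (rule zero closed_add; assumption)+
  next
    fix r s c assume r: "r \<in> carrier k" and s: "s \<in> carrier k" and c: "c \<in> carrier ?D"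
    show "(r \<oplus>\<^bsub>k\<^esub> s) \<odot>\<^bsub>?D\<^esub> c = r \<odot>\<^bsub>?D\<^esub> c \<oplus>\<^bsub>?D\<^esub> s \<odot>\<^bsub>?D\<^esub> c"
      by (rule dual_algebra_eqI[of _ k M]) (use r s c in \<open>simp_all add: closed dual_algebra_apply val M.R.l_distr\<close>)
    show "(r \<otimes>\<^bsub>k\<^esub> s) \<odot>\<^bsub>?D\<^esub> c = r \<odot>\<^bsub>?D\<^esub> (s \<odot>\<^bsub>?D\<^esub> c)"
      by (rule dual_algebra_eqI[of _ k M]) (use r s c in \<open>simp_all add: closed dual_algebra_apply val M.R.m_assoc\<close>)
  next
    fix r c d assume r: "r \<in> carrier k" and c: "c \<in> carrier ?D" and d: "d \<in> carrier ?D"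
    show "r \<odot>\<^bsub>?D\<^esub> (c \<oplus>\<^bsub>?D\<^esub> d) = r \<odot>\<^bsub>?D\<^esub> c \<oplus>\<^bsub>?D\<^esub> r \<odot>\<^bsub>?D\<^esub> d"
      by (rule dual_algebra_eqI[of _ k M]) (use r c d in \<open>simp_all add: closed dual_algebra_apply val M.R.r_distr\<close>)
  next
    fix c assume c: "c \<in> carrier ?D"
    show "\<one>\<^bsub>k\<^esub> \<odot>\<^bsub>?D\<^esub> c = c"
      by (rule dual_algebra_eqI[of _ k M]) (use c in \<open>simp_all add: closed dual_algebra_apply val\<close>)
  qed (auto intro: M.is_cring closed_smult)
qed

text \<open>The same finite families expand both \<open>M\<close> and its dual. The expansion of a
  form \<open>c\<close> follows from that of elements, since at \<open>a\<close> it reads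
  \<open>\<Sum> c(e_i) f_i(a) = c(\<Sum> f_i(a) e_i) = c(a)\<close>.\<close>

lemma dual_basis:
  assumes M: "fg_projective k M"
  obtains n :: nat and e f where "e \<in> {..<n} \<rightarrow> carrier M" "f \<in> {..<n} \<rightarrow> carrier (dual_algebra k M)"
    and "\<And>m. m \<in> carrier M \<Longrightarrow> (\<Oplus>\<^bsub>M\<^esub>i\<in>{..<n}. f i m \<odot>\<^bsub>M\<^esub> e i) = m"
    and "\<And>c. c \<in> carrier (dual_algebra k M) \<Longrightarrow>
      (\<Oplus>\<^bsub>dual_algebra k M\<^esub>i\<in>{..<n}. c (e i) \<odot>\<^bsub>dual_algebra k M\<^esub> f i) = c"
proof -
  let ?D = "dual_algebra k M"
  interpret M: module k M by (rule fg_projective_module[OF M])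
  interpret D: module k ?D by (rule module_dual_algebra[OF M.module_axioms])
  interpret R: module k "regular_module k" by (rule module_regular_module[OF M.is_cring])
  obtain n :: nat and e f where e: "e \<in> {..<n} \<rightarrow> carrier M"
    and f: "\<And>i. i < n \<Longrightarrow> f i \<in> lin_maps k M (regular_module k)"
    and gen: "\<And>m. m \<in> carrier M \<Longrightarrow> (\<Oplus>\<^bsub>M\<^esub>i\<in>{..<n}. f i m \<odot>\<^bsub>M\<^esub> e i) = m"
    by (rule fg_projective_finite_generation[OF M]) (rule that)
  \<comment> \<open>The coordinate forms become elements of the dual only after restriction to the
    carrier, where forms are represented by extensional functions.\<close>
  define g where "g i = restrict (f i) (carrier M)" for i
  have g: "g \<in> {..<n} \<rightarrow> carrier ?D"
    using dual_algebraI[OF M.module_axioms f] by (simp add: g_def)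
  have gen': "(\<Oplus>\<^bsub>M\<^esub>i\<in>{..<n}. g i m \<odot>\<^bsub>M\<^esub> e i) = m" if "m \<in> carrier M" for m
    using gen[OF that] that by (simp add: g_def)
  have val: "c a \<in> carrier k" if "c \<in> carrier ?D" "a \<in> carrier M" for c a
    using that by (rule dual_algebraD)
  show ?thesis
  proof (rule that[OF e g gen'])
    fix c assume c: "c \<in> carrier ?D"
    have ce: "c (e i) \<in> carrier k" "e i \<in> carrier M" "g i \<in> carrier ?D" if "i < n" for i
      using that e g c val by auto
    have sum: "(\<Oplus>\<^bsub>?D\<^esub>i\<in>{..<n}. c (e i) \<odot>\<^bsub>?D\<^esub> g i) \<in> carrier ?D"
      using ce by (intro D.finsum_closed) auto
    show "(\<Oplus>\<^bsub>?D\<^esub>i\<in>{..<n}. c (e i) \<odot>\<^bsub>?D\<^esub> g i) = c"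
    proof (rule dual_algebra_eqI[OF sum c])
      fix a assume a: "a \<in> carrier M"
      have "(\<Oplus>\<^bsub>?D\<^esub>i\<in>{..<n}. c (e i) \<odot>\<^bsub>?D\<^esub> g i) a =
          (\<Oplus>\<^bsub>regular_module k\<^esub>i\<in>{..<n}. (c (e i) \<odot>\<^bsub>?D\<^esub> g i) a)"
        by (rule lin_maps_finsum[OF D.module_axioms R.module_axioms eval_dual_algebra_lin[OF a]])
          (use ce in auto)
      also have "\<dots> = (\<Oplus>\<^bsub>regular_module k\<^esub>i\<in>{..<n}. c (g i a \<odot>\<^bsub>M\<^esub> e i))"
        by (rule R.finsum_cong')
          (use a ce val c in \<open>auto simp: dual_algebra_simps(4) lin_maps_smult[OF dual_algebraD(1)[OF c]] M.R.m_comm\<close>)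
      also have "\<dots> = c (\<Oplus>\<^bsub>M\<^esub>i\<in>{..<n}. g i a \<odot>\<^bsub>M\<^esub> e i)"
        by (rule lin_maps_finsum[OF M.module_axioms R.module_axioms dual_algebraD(1)[OF c], symmetric])
          (use a ce val in auto)
      also have "\<dots> = c a"
        by (simp add: gen'[OF a])
      finally show "(\<Oplus>\<^bsub>?D\<^esub>i\<in>{..<n}. c (e i) \<odot>\<^bsub>?D\<^esub> g i) a = c a" .
    qed
  qed
qed

text \<open>An element is recovered from its coordinates in a dual basis, and the coordinates are
  values of linear forms.\<close>

lemma dual_algebra_separates:
  assumes M: "fg_projective k M" and m: "m \<in> carrier M" "m' \<in> carrier M"
    and eq: "\<And>c. c \<in> carrier (dual_algebra k M) \<Longrightarrow> c m = c m'"
  shows "m = m'"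
proof -
  interpret M: module k M by (rule fg_projective_module[OF M])
  obtain n :: nat and e f where e: "e \<in> {..<n} \<rightarrow> carrier M" and f: "f \<in> {..<n} \<rightarrow> carrier (dual_algebra k M)"
    and gen: "\<And>m. m \<in> carrier M \<Longrightarrow> (\<Oplus>\<^bsub>M\<^esub>i\<in>{..<n}. f i m \<odot>\<^bsub>M\<^esub> e i) = m"
    by (rule dual_basis[OF M]) (rule that)
  have "(\<Oplus>\<^bsub>M\<^esub>i\<in>{..<n}. f i m \<odot>\<^bsub>M\<^esub> e i) = (\<Oplus>\<^bsub>M\<^esub>i\<in>{..<n}. f i m' \<odot>\<^bsub>M\<^esub> e i)"
  proof (rule M.finsum_cong'[OF refl funcsetI])
    fix i assume "i \<in> {..<n}"
    then have ef: "e i \<in> carrier M" "f i \<in> carrier (dual_algebra k M)"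
      using e f by auto
    show "f i m \<odot>\<^bsub>M\<^esub> e i = f i m' \<odot>\<^bsub>M\<^esub> e i"
      using ef by (simp add: eq)
    show "f i m' \<odot>\<^bsub>M\<^esub> e i \<in> carrier M"
      using ef dual_algebraD(2)[OF ef(2) m(2)] by simp
  qed
  then show ?thesis
    by (simp add: gen m)
qed

text \<open>Reflexivity of \<open>N\<close> in explicit form. A transpose \<open>s\<close> must have
  the coordinates \<open>f_i(s a) = h(f_i)(a)\<close>, which dictates the sum that defines it.
  Conversely \<open>d(s a) = \<Sum> h(f_i)(a) d(e_i) = h(\<Sum> d(e_i) f_i)(a) = h(d)(a)\<close>, by
  linearity of \<open>h\<close> and the expansion of \<open>d\<close>.\<close>

lemma dual_map_transpose:
  assumes M: "module k M" and N: "fg_projective k N"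
    and h: "h \<in> lin_maps k (dual_algebra k N) (dual_algebra k M)"
  shows "\<exists>s\<in>lin_maps k M N. \<forall>d\<in>carrier (dual_algebra k N). \<forall>a\<in>carrier M. d (s a) = h d a"
proof -
  interpret M: module k M by (rule M)
  interpret N: module k N by (rule fg_projective_module[OF N])
  let ?D = "dual_algebra k N"
  interpret D: module k ?D by (rule module_dual_algebra[OF N.module_axioms])
  interpret R: module k "regular_module k" by (rule module_regular_module[OF M.is_cring])
  obtain n :: nat and e f where e: "e \<in> {..<n} \<rightarrow> carrier N" and f: "f \<in> {..<n} \<rightarrow> carrier ?D"
    and gen: "\<And>d. d \<in> carrier ?D \<Longrightarrow> (\<Oplus>\<^bsub>?D\<^esub>i\<in>{..<n}. d (e i) \<odot>\<^bsub>?D\<^esub> f i) = d"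
    by (rule dual_basis[OF N]) (rule that)
  define s where "s a = (\<Oplus>\<^bsub>N\<^esub>i\<in>{..<n}. h (f i) a \<odot>\<^bsub>N\<^esub> e i)" for a
  have ef: "e i \<in> carrier N" "f i \<in> carrier ?D" "h (f i) \<in> lin_maps k M (regular_module k)" if "i < n" for i
    using that e f dual_algebraD(1)[OF lin_maps_closed[OF h]] by auto
  have val: "h (f i) a \<in> carrier k" if "i < n" "a \<in> carrier M" for i a
    using lin_maps_closed[OF ef(3)[OF that(1)] that(2)] by simp
  have "s \<in> lin_maps k M N"
  proof (rule lin_mapsI)
    fix a b assume a: "a \<in> carrier M" and b: "b \<in> carrier M"
    show "s a \<in> carrier N"
      unfolding s_def using ef val[OF _ a] by (intro N.finsum_closed) auto
    have "s (a \<oplus>\<^bsub>M\<^esub> b) = (\<Oplus>\<^bsub>N\<^esub>i\<in>{..<n}. h (f i) a \<odot>\<^bsub>N\<^esub> e i \<oplus>\<^bsub>N\<^esub> h (f i) b \<odot>\<^bsub>N\<^esub> e i)"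
      unfolding s_def
      by (rule N.finsum_cong') (use a b ef(1) val in \<open>auto simp: lin_maps_add[OF ef(3)] N.smult_l_distr\<close>)
    also have "\<dots> = s a \<oplus>\<^bsub>N\<^esub> s b"
      unfolding s_def by (rule N.finsum_addf) (use a b ef(1) val in auto)
    finally show "s (a \<oplus>\<^bsub>M\<^esub> b) = s a \<oplus>\<^bsub>N\<^esub> s b" .
  next
    fix r a assume r: "r \<in> carrier k" and a: "a \<in> carrier M"
    have "s (r \<odot>\<^bsub>M\<^esub> a) = (\<Oplus>\<^bsub>N\<^esub>i\<in>{..<n}. r \<odot>\<^bsub>N\<^esub> (h (f i) a \<odot>\<^bsub>N\<^esub> e i))"
      unfolding s_def
      by (rule N.finsum_cong') (use r a ef(1) val in \<open>auto simp: lin_maps_smult[OF ef(3)] N.smult_assoc1\<close>)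
    also have "\<dots> = r \<odot>\<^bsub>N\<^esub> s a"
      unfolding s_def by (rule N.finsum_smult_ldistr[symmetric]) (use r a ef(1) val in auto)
    finally show "s (r \<odot>\<^bsub>M\<^esub> a) = r \<odot>\<^bsub>N\<^esub> s a" .
  qed
  moreover have "d (s a) = h d a" if d: "d \<in> carrier ?D" and a: "a \<in> carrier M" for d a
  proof -
    note ha = lin_maps_compose[OF h eval_dual_algebra_lin[OF a]]
    have "d (s a) = (\<Oplus>\<^bsub>regular_module k\<^esub>i\<in>{..<n}. d (h (f i) a \<odot>\<^bsub>N\<^esub> e i))"
      unfolding s_def
      by (rule lin_maps_finsum[OF N.module_axioms R.module_axioms dual_algebraD(1)[OF d]]) (use a ef(1) val in auto)
    also have "\<dots> = (\<Oplus>\<^bsub>regular_module k\<^esub>i\<in>{..<n}. h (d (e i) \<odot>\<^bsub>?D\<^esub> f i) a)"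
      by (rule R.finsum_cong')
        (use a d ef val dual_algebraD(2)[OF d] in
          \<open>auto simp: lin_maps_smult[OF dual_algebraD(1)[OF d]] lin_maps_smult[OF ha] M.R.m_comm\<close>)
    also have "\<dots> = h (\<Oplus>\<^bsub>?D\<^esub>i\<in>{..<n}. d (e i) \<odot>\<^bsub>?D\<^esub> f i) a"
      by (rule lin_maps_finsum[OF D.module_axioms R.module_axioms ha, symmetric])
        (use ef dual_algebraD(2)[OF d] in auto)
    also have "\<dots> = h d a"
      by (simp add: gen[OF d])
    finally show ?thesis .
  qed
  ultimately show ?thesis
    by blast
qed

text \<open>The maps \<open>f\<close> and \<open>g\<close> are arbitrary so that one fact covers the
  pairing of the duals themselves, with identities, and the pairing of \<open>C\<close> with
  \<open>A\<close> through \<phi>. The order of the factors is that of the equation defining the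
  cocomposition in \<open>dual_category\<close>.\<close>

lemma dual_pairing_bilinear:
  assumes M: "module k M" and N: "module k N"
    and f: "f \<in> lin_maps k P (dual_algebra k M)" and g: "g \<in> lin_maps k Q (dual_algebra k N)"
    and b: "b \<in> carrier M" and a: "a \<in> carrier N"
  shows "(\<lambda>p q. g q a \<otimes>\<^bsub>k\<^esub> f p b) \<in> bilinear_maps k P Q (regular_module k)"
proof -
  interpret M: module k M by (rule M)
  note fb = lin_maps_compose[OF f eval_dual_algebra_lin[OF b]]
  note ga = lin_maps_compose[OF g eval_dual_algebra_lin[OF a]]
  note cl = lin_maps_closed[OF fb, simplified] lin_maps_closed[OF ga, simplified]
  show ?thesis
    by (intro bilinear_mapsI lin_mapsI)
      (simp_all add: cl lin_maps_add[OF fb] lin_maps_add[OF ga] lin_maps_smult[OF fb] lin_maps_smult[OF ga]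
        M.R.l_distr M.R.r_distr M.R.m_assoc M.R.m_lcomm)
qed

text \<open>Since \<open>M\<close> has a dual basis \<open>e\<^sub>i, f\<^sub>i\<close>, the form \<open>g\<close> is represented by
  \<open>\<Sum>\<^sub>i f\<^sub>i \<otimes> g(-, e\<^sub>i)\<close>.\<close>

lemma bilinear_form_representation:
  assumes M: "fg_projective k M" and N: "module k N"
    and g: "g \<in> bilinear_maps k N M (regular_module k)"
  defines "D1 \<equiv> dual_algebra k M" and "D2 \<equiv> dual_algebra k N"
  shows "\<exists>!t. t \<in> carrier (tensor_module k D1 D2) \<and>
    (\<forall>a\<in>carrier N. \<forall>b\<in>carrier M. g a b =
      tensor_lift k D1 D2 (regular_module k) (\<lambda>c1 c2. c2 a \<otimes>\<^bsub>k\<^esub> c1 b) t)"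
proof -
  interpret M: module k M by (rule fg_projective_module[OF M])
  interpret D1: module k D1 unfolding D1_def by (rule module_dual_algebra[OF M.module_axioms])
  interpret D2: module k D2 unfolding D2_def by (rule module_dual_algebra[OF N])
  interpret R: module k "regular_module k" by (rule module_regular_module[OF M.is_cring])
  let ?T = "tensor_module k D1 D2"
  interpret T: module k ?T by (rule module_tensor_module[OF D1.module_axioms D2.module_axioms])
  note pb = bilinear_mapsD[OF pure_tensor_bilinear[OF D1.module_axioms D2.module_axioms]]
  obtain n :: nat and e f where e: "e \<in> {..<n} \<rightarrow> carrier M" and f: "f \<in> {..<n} \<rightarrow> carrier D1"
    and gen: "\<And>m. m \<in> carrier M \<Longrightarrow> (\<Oplus>\<^bsub>M\<^esub>i\<in>{..<n}. f i m \<odot>\<^bsub>M\<^esub> e i) = m"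
    and gen': "\<And>c. c \<in> carrier D1 \<Longrightarrow> (\<Oplus>\<^bsub>D1\<^esub>i\<in>{..<n}. c (e i) \<odot>\<^bsub>D1\<^esub> f i) = c"
    by (rule dual_basis[OF M, folded D1_def]) (rule that)
  have ef: "e i \<in> carrier M" "f i \<in> carrier D1" if "i < n" for i
    using that e f by auto
  have D1_val: "c b \<in> carrier k" if "c \<in> carrier D1" "b \<in> carrier M" for c b
    using that unfolding D1_def by (rule dual_algebraD(2))
  have D2_val: "c a \<in> carrier k" if "c \<in> carrier D2" "a \<in> carrier N" for c a
    using that unfolding D2_def by (rule dual_algebraD(2))
  define L where "L a b = tensor_lift k D1 D2 (regular_module k) (\<lambda>c1 c2. c2 a \<otimes>\<^bsub>k\<^esub> c1 b)" for a b
  have bil: "(\<lambda>c1 c2. c2 a \<otimes>\<^bsub>k\<^esub> c1 b) \<in> bilinear_maps k D1 D2 (regular_module k)"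
    if "a \<in> carrier N" "b \<in> carrier M" for a b
    using dual_pairing_bilinear[OF M.module_axioms N lin_maps_id lin_maps_id that(2,1)]
    unfolding D1_def D2_def by simp
  have L: "L a b \<in> lin_maps k ?T (regular_module k)" if "a \<in> carrier N" "b \<in> carrier M" for a b
    unfolding L_def by (rule tensor_lift_lin[OF D1.module_axioms D2.module_axioms R.module_axioms bil[OF that]])
  have L_pure: "L a b (pure_tensor k D1 D2 c1 c2) = c2 a \<otimes>\<^bsub>k\<^esub> c1 b"
    if "a \<in> carrier N" "b \<in> carrier M" "c1 \<in> carrier D1" "c2 \<in> carrier D2" for a b c1 c2
    unfolding L_def
    by (rule tensor_lift_pure[OF D1.module_axioms D2.module_axioms R.module_axioms bil[OF that(1,2)] that(3,4)])
  have "\<exists>t\<in>carrier ?T. \<forall>a\<in>carrier N. \<forall>b\<in>carrier M. g a b = L a b t"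
  proof (intro bexI ballI)
    define G where "G i = (\<lambda>a\<in>carrier N. g a (e i))" for i
    have G: "G i \<in> carrier D2" if "i < n" for i
      unfolding G_def D2_def
      by (rule dual_algebraI[OF N bilinear_mapsD(2)[OF g ef(1)[OF that]]])
    have tm: "pure_tensor k D1 D2 (f i) (G i) \<in> carrier ?T" if "i < n" for i
      by (rule pure_tensor_closed[OF D1.module_axioms D2.module_axioms ef(2)[OF that] G[OF that]])
    let ?t = "\<Oplus>\<^bsub>?T\<^esub>i\<in>{..<n}. pure_tensor k D1 D2 (f i) (G i)"
    show "?t \<in> carrier ?T"
      using tm by (intro T.finsum_closed) auto
    fix a b assume a: "a \<in> carrier N" and b: "b \<in> carrier M"
    note ga = bilinear_mapsD(1)[OF g a]
    have "L a b ?t = (\<Oplus>\<^bsub>regular_module k\<^esub>i\<in>{..<n}. L a b (pure_tensor k D1 D2 (f i) (G i)))"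
      by (rule lin_maps_finsum[OF T.module_axioms R.module_axioms L[OF a b]]) (use tm in auto)
    also have "\<dots> = (\<Oplus>\<^bsub>regular_module k\<^esub>i\<in>{..<n}. g a (f i b \<odot>\<^bsub>M\<^esub> e i))"
      by (rule R.finsum_cong')
        (use a b ef G D1_val lin_maps_closed[OF ga] in
          \<open>auto simp: L_pure lin_maps_smult[OF ga] G_def M.R.m_comm\<close>)
    also have "\<dots> = g a (\<Oplus>\<^bsub>M\<^esub>i\<in>{..<n}. f i b \<odot>\<^bsub>M\<^esub> e i)"
      by (rule lin_maps_finsum[OF M.module_axioms R.module_axioms ga, symmetric]) (use b ef D1_val in auto)
    finally show "g a b = L a b ?t"
      by (simp add: gen[OF b])
  qed
  moreover have "s = t" if s: "s \<in> carrier ?T" and t: "t \<in> carrier ?T"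
    and eq: "\<And>a b. a \<in> carrier N \<Longrightarrow> b \<in> carrier M \<Longrightarrow> L a b s = L a b t" for s t
  proof -
    \<comment> \<open>Contraction of the first tensor factor against \<open>e i\<close>. It collects
      the scalars \<open>L a (e i) u\<close>, for varying \<open>a\<close>, into a single element of
      \<open>D2\<close>.\<close>
    define K where "K i = tensor_lift k D1 D2 D2 (\<lambda>c1 c2. c1 (e i) \<odot>\<^bsub>D2\<^esub> c2)" for i
    have K_bil: "(\<lambda>c1 c2. c1 (e i) \<odot>\<^bsub>D2\<^esub> c2) \<in> bilinear_maps k D1 D2 D2" if "i < n" for i
    proof -
      have ev: "(\<lambda>c. c (e i)) \<in> lin_maps k D1 (regular_module k)"
        unfolding D1_def by (rule eval_dual_algebra_lin[OF ef(1)[OF that]])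
      note cl = lin_maps_closed[OF ev, simplified]
      show ?thesis
        by (intro bilinear_mapsI lin_mapsI)
          (simp_all add: cl lin_maps_add[OF ev] lin_maps_smult[OF ev] D2.smult_l_distr D2.smult_r_distr
            D2.smult_assoc1[symmetric] M.R.m_comm)
    qed
    have K: "K i \<in> lin_maps k ?T D2" if "i < n" for i
      unfolding K_def by (rule tensor_lift_lin[OF D1.module_axioms D2.module_axioms D2.module_axioms K_bil[OF that]])
    have K_pure: "K i (pure_tensor k D1 D2 c1 c2) = c1 (e i) \<odot>\<^bsub>D2\<^esub> c2"
      if "i < n" "c1 \<in> carrier D1" "c2 \<in> carrier D2" for i c1 c2
      unfolding K_def by (rule tensor_lift_pure[OF D1.module_axioms D2.module_axioms D2.module_axioms K_bil[OF that(1)] that(2,3)])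
    have K_eval: "K i u a = L a (e i) u" if i: "i < n" and a: "a \<in> carrier N" and u: "u \<in> carrier ?T" for i a u
    proof -
      have ev: "(\<lambda>c. c a) \<in> lin_maps k D2 (regular_module k)"
        unfolding D2_def by (rule eval_dual_algebra_lin[OF a])
      show ?thesis
        by (rule tensor_module_lin_maps_eqI[OF D1.module_axioms D2.module_axioms R.module_axioms
            lin_maps_compose[OF K[OF i] ev] L[OF a ef(1)[OF i]] _ u])
          (use i a ef D1_val D2_val in
            \<open>simp add: K_pure L_pure lin_maps_smult[OF ev] M.R.m_comm\<close>)
    qed
    \<comment> \<open>For a pure tensor, the scalar \<open>c1 (e i)\<close> is moved from the second
      factor to the first, where the dual basis expansion restores \<open>c1\<close>. A tensor is
      thus determined by its contractions, hence by the values of \<open>L\<close>.\<close>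
    have expand: "(\<Oplus>\<^bsub>?T\<^esub>i\<in>{..<n}. pure_tensor k D1 D2 (f i) (K i u)) = u" if "u \<in> carrier ?T" for u
      using that
    proof (induction rule: tensor_induct[OF D1.module_axioms D2.module_axioms, consumes 1, case_names pure add])
      case (pure c1 c2)
      note pb2 = pb(2)[OF pure(2)]
      have "(\<Oplus>\<^bsub>?T\<^esub>i\<in>{..<n}. pure_tensor k D1 D2 (f i) (K i (pure_tensor k D1 D2 c1 c2))) =
          (\<Oplus>\<^bsub>?T\<^esub>i\<in>{..<n}. pure_tensor k D1 D2 (c1 (e i) \<odot>\<^bsub>D1\<^esub> f i) c2)"
        by (rule T.finsum_cong')
          (use pure ef D1_val in \<open>auto simp: K_pure lin_maps_smult[OF pb(1)] lin_maps_smult[OF pb2]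
            intro!: pure_tensor_closed[OF D1.module_axioms D2.module_axioms] T.smult_closed\<close>)
      also have "\<dots> = pure_tensor k D1 D2 (\<Oplus>\<^bsub>D1\<^esub>i\<in>{..<n}. c1 (e i) \<odot>\<^bsub>D1\<^esub> f i) c2"
        by (rule lin_maps_finsum[OF D1.module_axioms T.module_axioms pb2, symmetric])
          (use pure ef D1_val in auto)
      finally show ?case
        by (simp add: gen'[OF pure(1)])
    next
      case (add u v)
      have "(\<Oplus>\<^bsub>?T\<^esub>i\<in>{..<n}. pure_tensor k D1 D2 (f i) (K i (u \<oplus>\<^bsub>?T\<^esub> v))) =
        (\<Oplus>\<^bsub>?T\<^esub>i\<in>{..<n}. pure_tensor k D1 D2 (f i) (K i u) \<oplus>\<^bsub>?T\<^esub> pure_tensor k D1 D2 (f i) (K i v))"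
        by (rule T.finsum_cong')
          (use add(1,2) ef lin_maps_closed[OF K] in \<open>auto simp: lin_maps_add[OF K] lin_maps_add[OF pb(1)]
            intro!: pure_tensor_closed[OF D1.module_axioms D2.module_axioms] T.a_closed\<close>)
      also have "\<dots> = (\<Oplus>\<^bsub>?T\<^esub>i\<in>{..<n}. pure_tensor k D1 D2 (f i) (K i u)) \<oplus>\<^bsub>?T\<^esub>
          (\<Oplus>\<^bsub>?T\<^esub>i\<in>{..<n}. pure_tensor k D1 D2 (f i) (K i v))"
        by (rule T.finsum_addf)
          (use add(1,2) ef lin_maps_closed[OF K] in \<open>auto
            intro!: pure_tensor_closed[OF D1.module_axioms D2.module_axioms]\<close>)
      finally show ?case
        by (simp add: add)
    qed
    have "K i s = K i t" if "i < n" for i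
      using lin_maps_closed[OF K[OF that] s] lin_maps_closed[OF K[OF that] t] unfolding D2_def
      by (rule dual_algebra_eqI) (simp add: K_eval that s t eq ef(1))
    then have "(\<Oplus>\<^bsub>?T\<^esub>i\<in>{..<n}. pure_tensor k D1 D2 (f i) (K i s)) =
        (\<Oplus>\<^bsub>?T\<^esub>i\<in>{..<n}. pure_tensor k D1 D2 (f i) (K i t))"
      by (intro T.finsum_cong')
        (use ef lin_maps_closed[OF K t] in \<open>auto
            intro!: pure_tensor_closed[OF D1.module_axioms D2.module_axioms]\<close>)
    then show "s = t"
      by (simp add: expand s t)
  qed
  ultimately show ?thesis
    unfolding L_def[symmetric] by (metis (no_types, lifting))
qed

section \<open>Transposing antipodes\<close>

text \<open>\<open>lin_maps\<close> reads only the carrier, the addition and the scalar action, and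
  the coalgebra fields are added on top of these.\<close>

lemma lin_maps_tensor_coalgebra:
  "lin_maps k (tensor_coalgebra k M N) P = lin_maps k (tensor_module k M N) P"
  by (simp add: lin_maps_def tensor_coalgebra_def module.defs coalgebra.defs)

lemma lin_maps_tensor_algebra:
  "lin_maps k P (tensor_algebra k M N) = lin_maps k P (tensor_module k M N)"
  by (simp add: lin_maps_def tensor_algebra_def Let_def)

text \<open>Fixing the isomorphism turns the correspondence into a pairing: for \<open>c\<close> in
  \<open>dhom C x y\<close> and \<open>a\<close> in \<open>mor A y x\<close>, the scalar
  \<open>\<phi> x y c a\<close> stands for \<open>\<langle>c, a\<rangle>\<close>. The elements of
  \<open>C\<close> can then be of any type.\<close>

locale category_duality =
  fixes k :: "('k, 'r) ring_scheme" and X :: "'x set"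
    and A :: "('k, 'x, 'a) coalg_cat" and C :: "('k, 'x, 'c) dual_alg_cat"
    and \<phi> :: "'x \<Rightarrow> 'x \<Rightarrow> 'c \<Rightarrow> 'a \<Rightarrow> 'k"
  assumes cring: "cring k"
    and A: "coalgebra_category k X A"
    and C: "dual_algebra_category k X C"
    and iso: "dual_alg_cat_iso k X C (dual_category k A) \<phi>"
begin

lemma module_k: "module k (regular_module k)"
  by (rule module_regular_module[OF cring])

section \<open>The structure maps of \<open>A\<close> and \<open>C\<close> seen through the
  pairing\<close>

context
  fixes x y
  assumes x: "x \<in> X" and y: "y \<in> X"
begin

lemma fg_projective_mor: "fg_projective k (mor A x y)"
  and comult_lin: "comult (mor A x y) \<in> lin_maps k (mor A x y) (tensor_module k (mor A x y) (mor A x y))"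
  and counit_lin: "counit (mor A x y) \<in> lin_maps k (mor A x y) (regular_module k)"
  using A x y by (auto simp: coalgebra_category_def fgp_coalgebra_def)

lemmas module_mor = fg_projective_module[OF fg_projective_mor]

lemma fgp_algebra_dhom: "fgp_algebra k (dhom C x y)"
  using C x y by (simp add: dual_algebra_category_def)

lemma module_dhom: "module k (dhom C x y)"
  using fgp_algebra_dhom by (simp add: fgp_algebra_def fg_projective_module)

lemma mult_dhom_bilinear: "(\<lambda>c d. c \<otimes>\<^bsub>dhom C x y\<^esub> d) \<in> bilinear_maps k (dhom C x y) (dhom C x y) (dhom C x y)"
proof -
  have "ring (dhom C x y)"
    using fgp_algebra_dhom by (simp add: fgp_algebra_def)
  then interpret ring "dhom C x y" .
  show ?thesis
    using fgp_algebra_dhom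
    by (intro bilinear_mapsI lin_mapsI) (simp_all add: fgp_algebra_def l_distr r_distr)
qed

lemma phi_lin: "\<phi> x y \<in> lin_maps k (dhom C x y) (dual_algebra k (mor A y x))"
  and phi_ring_hom: "\<phi> x y \<in> ring_hom (dhom C x y) (dual_algebra k (mor A y x))"
  and phi_bij: "bij_betw (\<phi> x y) (carrier (dhom C x y)) (carrier (dual_algebra k (mor A y x)))"
  using iso x y by (auto simp: dual_alg_cat_iso_def dual_category_def algebra_homs_def)

text \<open>Nondegeneracy of the pairing in its first variable: extensional forms are determined by
  their values on the carrier, and \<phi> is injective. In the second variable,
  \<open>dual_algebra_separates\<close> combined with surjectivity of \<phi> plays this
  part.\<close>

lemma phi_inj:
  assumes "c \<in> carrier (dhom C x y)" "d \<in> carrier (dhom C x y)"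
    and "\<And>a. a \<in> carrier (mor A y x) \<Longrightarrow> \<phi> x y c a = \<phi> x y d a"
  shows "c = d"
proof -
  have "\<phi> x y c = \<phi> x y d"
    using lin_maps_closed[OF phi_lin] assms by (intro dual_algebra_eqI[of _ k "mor A y x"]) auto
  then show ?thesis
    using phi_bij assms(1,2) by (auto simp: bij_betw_def inj_on_def)
qed

lemma phi_eval_lin: "a \<in> carrier (mor A y x) \<Longrightarrow> (\<lambda>c. \<phi> x y c a) \<in> lin_maps k (dhom C x y) (regular_module k)"
  by (rule lin_maps_compose[OF phi_lin eval_dual_algebra_lin])

lemma phi_apply_lin: "c \<in> carrier (dhom C x y) \<Longrightarrow> \<phi> x y c \<in> lin_maps k (mor A y x) (regular_module k)"
  by (rule dual_algebraD(1)[OF lin_maps_closed[OF phi_lin]])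

lemma phi_one: "a \<in> carrier (mor A y x) \<Longrightarrow> \<phi> x y \<one>\<^bsub>dhom C x y\<^esub> a = counit (mor A y x) a"
  using ring_hom_one[OF phi_ring_hom] by (simp add: dual_algebra_def)

lemma phi_mult:
  assumes "c \<in> carrier (dhom C x y)" "d \<in> carrier (dhom C x y)" "a \<in> carrier (mor A y x)"
  shows "\<phi> x y (c \<otimes>\<^bsub>dhom C x y\<^esub> d) a =
    tensor_lift k (mor A y x) (mor A y x) (regular_module k) (\<lambda>a1 a2. \<phi> x y c a2 \<otimes>\<^bsub>k\<^esub> \<phi> x y d a1)
      (comult (mor A y x) a)"
  using ring_hom_mult[OF phi_ring_hom assms(1,2)] assms(3) by (simp add: dual_algebra_def)

end

context
  fixes x y z
  assumes x: "x \<in> X" and y: "y \<in> X" and z: "z \<in> X"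
begin

lemma comp_map_lin: "comp_map A x y z \<in> lin_maps k (tensor_module k (mor A x y) (mor A y z)) (mor A x z)"
proof -
  have "comp_map A x y z \<in> coalgebra_homs k (tensor_coalgebra k (mor A x y) (mor A y z)) (mor A x z)"
    using A x y z unfolding coalgebra_category_def by blast
  then show ?thesis
    by (simp add: coalgebra_homs_def lin_maps_tensor_coalgebra)
qed

lemma mor_comp_bilinear: "mor_comp k A x y z \<in> bilinear_maps k (mor A x y) (mor A y z) (mor A x z)"
  unfolding mor_comp_def
  using bilinear_mapsD[OF pure_tensor_bilinear[OF module_mor[OF x y] module_mor[OF y z]]]
  by (intro bilinear_mapsI lin_maps_compose[OF _ comp_map_lin])

lemma cocomp_lin: "cocomp C x y z \<in> lin_maps k (dhom C x z) (tensor_module k (dhom C x y) (dhom C y z))"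
proof -
  have "cocomp C x y z \<in> algebra_homs k (dhom C x z) (tensor_algebra k (dhom C x y) (dhom C y z))"
    using C x y z unfolding dual_algebra_category_def by blast
  then show ?thesis
    by (simp add: algebra_homs_def lin_maps_tensor_algebra)
qed

end

text \<open>The form sending \<open>a\<close> and \<open>b\<close> to
  \<open>\<langle>c, ab\<rangle>\<close> is bilinear, so \<open>bilinear_form_representation\<close>
  shows that the definite description in \<open>dual_category\<close> denotes the tensor
  representing it. Compatibility of \<phi> with cocomposition exhibits this tensor as the image of
  \<open>cocomp C x y z c\<close>, and the substitution rule then moves \<phi> into the
  integrand.\<close>

lemma cocomp_pairing:
  assumes x: "x \<in> X" and y: "y \<in> X" and z: "z \<in> X"
    and c: "c \<in> carrier (dhom C x z)" and a: "a \<in> carrier (mor A z y)" and b: "b \<in> carrier (mor A y x)"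
  shows "tensor_lift k (dhom C x y) (dhom C y z) (regular_module k)
      (\<lambda>c1 c2. \<phi> y z c2 a \<otimes>\<^bsub>k\<^esub> \<phi> x y c1 b) (cocomp C x y z c) =
    \<phi> x z c (mor_comp k A z y x a b)"
proof -
  let ?D1 = "dual_algebra k (mor A y x)" and ?D2 = "dual_algebra k (mor A z y)"
  let ?L = "\<lambda>a b. tensor_lift k ?D1 ?D2 (regular_module k) (\<lambda>c1 c2. c2 a \<otimes>\<^bsub>k\<^esub> c1 b)"
  let ?t = "cocomp (dual_category k A) x y z (\<phi> x z c)"
  note Ayx = module_mor[OF y x] and Azy = module_mor[OF z y]
  note D1 = module_dual_algebra[OF Ayx] and D2 = module_dual_algebra[OF Azy]
  note Cxy = module_dhom[OF x y] and Cyz = module_dhom[OF y z]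
  note fxy = phi_lin[OF x y] and fyz = phi_lin[OF y z]
  have bil: "(\<lambda>a b. \<phi> x z c (mor_comp k A z y x a b)) \<in> bilinear_maps k (mor A z y) (mor A y x) (regular_module k)"
    by (intro bilinear_mapsI lin_maps_compose[OF _ phi_apply_lin[OF x z c]] bilinear_mapsD[OF mor_comp_bilinear[OF z y x]])
  have "?t = (THE t. t \<in> carrier (tensor_module k ?D1 ?D2) \<and>
      (\<forall>a\<in>carrier (mor A z y). \<forall>b\<in>carrier (mor A y x). \<phi> x z c (mor_comp k A z y x a b) = ?L a b t))"
    by (simp add: dual_category_def Let_def)
  with theI'[OF bilinear_form_representation[OF fg_projective_mor[OF y x] Azy bil]]
  have "\<phi> x z c (mor_comp k A z y x a b) = ?L a b ?t"
    using a b by simp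
  also have "?t = tensor_map k (dhom C x y) (dhom C y z) ?D1 ?D2 (\<phi> x y) (\<phi> y z) (cocomp C x y z c)"
  proof -
    have "?t = tensor_map k (dhom C x y) (dhom C y z) (dhom (dual_category k A) x y) (dhom (dual_category k A) y z)
        (\<phi> x y) (\<phi> y z) (cocomp C x y z c)"
      using iso x y z c unfolding dual_alg_cat_iso_def by blast
    then show ?thesis
      by (simp add: dual_category_def)
  qed
  also have "?L a b \<dots> = tensor_lift k (dhom C x y) (dhom C y z) (regular_module k)
      (\<lambda>c1 c2. \<phi> y z c2 a \<otimes>\<^bsub>k\<^esub> \<phi> x y c1 b) (cocomp C x y z c)"
    using dual_pairing_bilinear[OF Ayx Azy lin_maps_id lin_maps_id b a]
    by (intro tensor_lift_tensor_map[OF Cxy Cyz D1 D2 module_k fxy fyz _ lin_maps_closed[OF cocomp_lin[OF x y z] c]]) simp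
  finally show ?thesis
    by simp
qed

text \<open>One computation serves both antipode equations: either \<open>P\<close> and
  \<open>v\<close> are identities while \<open>Q\<close> and \<open>u\<close> are an antipode and
  its transpose, or the roles are exchanged. The objects \<open>p\<close> and \<open>q\<close> stay
  free because the target is \<open>dhom C x y\<close> in one case and \<open>dhom C y x\<close> in
  the other. In Sweedler notation, \<open>\<langle>P(c_1) Q(c_2), a\<rangle> = \<langle>c_1,
  v(a_2)\<rangle> \<langle>c_2, u(a_1)\<rangle> = \<langle>c, u(a_1) v(a_2)\<rangle>\<close>: the
  map on the second leg of \<open>c\<close> acts on the left factor of the composite.\<close>

lemma convolution_transpose:
  assumes x: "x \<in> X" and y: "y \<in> X" and p: "p \<in> X" and q: "q \<in> X"
    and P: "P \<in> lin_maps k (dhom C x y) (dhom C q p)" and Q: "Q \<in> lin_maps k (dhom C y x) (dhom C q p)"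
    and u: "u \<in> lin_maps k (mor A p q) (mor A x y)" and v: "v \<in> lin_maps k (mor A p q) (mor A y x)"
    and Pv: "\<And>c a. c \<in> carrier (dhom C x y) \<Longrightarrow> a \<in> carrier (mor A p q) \<Longrightarrow> \<phi> q p (P c) a = \<phi> x y c (v a)"
    and Qu: "\<And>c a. c \<in> carrier (dhom C y x) \<Longrightarrow> a \<in> carrier (mor A p q) \<Longrightarrow> \<phi> q p (Q c) a = \<phi> y x c (u a)"
    and c: "c \<in> carrier (dhom C x x)" and a: "a \<in> carrier (mor A p q)"
  shows "\<phi> q p (mult_map k (dhom C q p)
        (tensor_map k (dhom C x y) (dhom C y x) (dhom C q p) (dhom C q p) P Q (cocomp C x y x c))) a =
    \<phi> x x c (comp_map A x y x
        (tensor_map k (mor A p q) (mor A p q) (mor A x y) (mor A y x) u v (comult (mor A p q) a)))"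
proof -
  let ?R = "regular_module k" and ?M = "mor A p q" and ?E = "dhom C q p"
  let ?lift_C = "tensor_lift k (dhom C x y) (dhom C y x)" and ?lift_M = "tensor_lift k ?M ?M ?R"
  define t where "t = cocomp C x y x c"
  define w where "w = comult ?M a"
  note M = module_mor[OF p q] and E = module_dhom[OF q p]
  note Axy = module_mor[OF x y] and Ayx = module_mor[OF y x]
  note Cxy = module_dhom[OF x y] and Cyx = module_dhom[OF y x]
  note mult = mult_dhom_bilinear[OF q p]
  have t: "t \<in> carrier (tensor_module k (dhom C x y) (dhom C y x))"
    unfolding t_def by (rule lin_maps_closed[OF cocomp_lin[OF x y x] c])
  have w: "w \<in> carrier (tensor_module k ?M ?M)"
    unfolding w_def by (rule lin_maps_closed[OF comult_lin[OF p q] a])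
  have PQ: "(\<lambda>c1 c2. P c1 \<otimes>\<^bsub>?E\<^esub> Q c2) \<in> bilinear_maps k (dhom C x y) (dhom C y x) ?E"
    by (intro bilinear_mapsI lin_maps_compose[OF P bilinear_mapsD(2)[OF mult]]
        lin_maps_compose[OF Q bilinear_mapsD(1)[OF mult]] lin_maps_closed[OF P] lin_maps_closed[OF Q])
  interpret cring k by (rule cring)
  have val_v: "\<phi> x y c1 (v a2) \<in> carrier k" if "c1 \<in> carrier (dhom C x y)" "a2 \<in> carrier ?M" for c1 a2
    using lin_maps_closed[OF phi_apply_lin[OF x y that(1)] lin_maps_closed[OF v that(2)]] by simp
  have val_u: "\<phi> y x c2 (u a1) \<in> carrier k" if "c2 \<in> carrier (dhom C y x)" "a1 \<in> carrier ?M" for c2 a1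
    using lin_maps_closed[OF phi_apply_lin[OF y x that(1)] lin_maps_closed[OF u that(2)]] by simp
  \<comment> \<open>The integrand in all four variables, with its factors in the order of
    \<open>cocomp_pairing\<close>. The convolution formula delivers them in the opposite order,
    which commutativity of \<open>k\<close> repairs.\<close>
  define B where "B c1 c2 a1 a2 = \<phi> y x c2 (u a1) \<otimes>\<^bsub>k\<^esub> \<phi> x y c1 (v a2)" for c1 c2 a1 a2
  have B1: "(\<lambda>c1 c2. B c1 c2 a1 a2) \<in> bilinear_maps k (dhom C x y) (dhom C y x) ?R"
    if "a1 \<in> carrier ?M" "a2 \<in> carrier ?M" for a1 a2
    unfolding B_def
    by (rule dual_pairing_bilinear[OF Ayx Axy phi_lin[OF x y] phi_lin[OF y x]
          lin_maps_closed[OF v that(2)] lin_maps_closed[OF u that(1)]])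
  have B2: "B c1 c2 \<in> bilinear_maps k ?M ?M ?R"
    if "c1 \<in> carrier (dhom C x y)" "c2 \<in> carrier (dhom C y x)" for c1 c2
  proof -
    note l1 = lin_maps_compose[OF v phi_apply_lin[OF x y that(1)]]
    note l2 = lin_maps_compose[OF u phi_apply_lin[OF y x that(2)]]
    show ?thesis
      unfolding B_def
      by (intro bilinear_mapsI lin_mapsI)
        (simp_all add: val_v val_u that lin_maps_add[OF l1] lin_maps_add[OF l2]
          lin_maps_smult[OF l1] lin_maps_smult[OF l2] l_distr r_distr m_assoc m_lcomm)
  qed
  have "mult_map k ?E (tensor_map k (dhom C x y) (dhom C y x) ?E ?E P Q t) =
      ?lift_C ?E (\<lambda>c1 c2. P c1 \<otimes>\<^bsub>?E\<^esub> Q c2) t"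
    unfolding mult_map_def by (rule tensor_lift_tensor_map[OF Cxy Cyx E E E P Q mult t])
  then have "\<phi> q p (mult_map k ?E (tensor_map k (dhom C x y) (dhom C y x) ?E ?E P Q t)) a =
      ?lift_C ?R (\<lambda>c1 c2. \<phi> q p (P c1 \<otimes>\<^bsub>?E\<^esub> Q c2) a) t"
    using lin_map_tensor_lift[OF Cxy Cyx E module_k PQ phi_eval_lin[OF q p a] t] by simp
  also have "\<dots> = ?lift_C ?R (\<lambda>c1 c2. ?lift_M (B c1 c2) w) t"
  proof (intro fun_cong[OF tensor_lift_cong])
    fix c1 c2 assume c1: "c1 \<in> carrier (dhom C x y)" and c2: "c2 \<in> carrier (dhom C y x)"
    have "\<phi> q p (P c1 \<otimes>\<^bsub>?E\<^esub> Q c2) a = ?lift_M (\<lambda>a1 a2. \<phi> q p (P c1) a2 \<otimes>\<^bsub>k\<^esub> \<phi> q p (Q c2) a1) w"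
      unfolding w_def by (rule phi_mult[OF q p lin_maps_closed[OF P c1] lin_maps_closed[OF Q c2] a])
    also have "\<dots> = ?lift_M (B c1 c2) w"
      by (intro fun_cong[OF tensor_lift_cong]) (simp add: B_def Pv Qu c1 c2 val_v val_u m_comm)
    finally show "\<phi> q p (P c1 \<otimes>\<^bsub>?E\<^esub> Q c2) a = ?lift_M (B c1 c2) w" .
  qed
  \<comment> \<open>The exchange of sums brings the one over \<open>c\<close> inside, where
    \<open>cocomp_pairing\<close> evaluates it.\<close>
  also have "\<dots> = ?lift_M (\<lambda>a1 a2. ?lift_C ?R (\<lambda>c1 c2. B c1 c2 a1 a2) t) w"
    by (rule tensor_lift_swap[OF Cxy Cyx M M module_k B1 B2 t w])
  also have "\<dots> = ?lift_M (\<lambda>a1 a2. \<phi> x x c (mor_comp k A x y x (u a1) (v a2))) w"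
    unfolding B_def t_def
    by (intro fun_cong[OF tensor_lift_cong] cocomp_pairing x y c lin_maps_closed[OF u] lin_maps_closed[OF v])
  \<comment> \<open>The remaining sum over \<open>a\<close> is a composite of linear maps,
    recognised by its values on pure tensors.\<close>
  also have "\<dots> = \<phi> x x c (comp_map A x y x (tensor_map k ?M ?M (mor A x y) (mor A y x) u v w))"
  proof (rule tensor_lift_unique[OF M M module_k _ _ _ w])
    note mc = bilinear_mapsD[OF mor_comp_bilinear[OF x y x]]
    show "(\<lambda>a1 a2. \<phi> x x c (mor_comp k A x y x (u a1) (v a2))) \<in> bilinear_maps k ?M ?M ?R"
      by (intro bilinear_mapsI lin_maps_compose[OF _ phi_apply_lin[OF x x c]]
          lin_maps_compose[OF u mc(2)] lin_maps_compose[OF v mc(1)] lin_maps_closed[OF u] lin_maps_closed[OF v])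
    show "(\<lambda>w. \<phi> x x c (comp_map A x y x (tensor_map k ?M ?M (mor A x y) (mor A y x) u v w)))
        \<in> lin_maps k (tensor_module k ?M ?M) ?R"
      by (intro lin_maps_compose[OF lin_maps_compose[OF tensor_map_lin[OF M M Axy Ayx u v] comp_map_lin[OF x y x]]
          phi_apply_lin[OF x x c]])
    show "\<phi> x x c (comp_map A x y x (tensor_map k ?M ?M (mor A x y) (mor A y x) u v (pure_tensor k ?M ?M a1 a2))) =
        \<phi> x x c (mor_comp k A x y x (u a1) (v a2))" if "a1 \<in> carrier ?M" "a2 \<in> carrier ?M" for a1 a2
      by (simp add: tensor_map_pure[OF M M Axy Ayx u v that] mor_comp_def)
  qed
  finally show ?thesis
    unfolding t_def w_def .
qed

text \<open>The two sides of the equation for \<open>C\<close> at \<open>c\<close>, paired with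
  \<open>a\<close>, equal the two sides of the equation for \<open>A\<close> at \<open>a\<close>,
  paired with \<open>c\<close>. Nondegeneracy in either variable strips off the pairing: every form
  on \<open>mor A x x\<close> is some \<open>\<phi> x x c\<close> and such forms separate elements,
  while \<open>phi_inj\<close> handles the converse.\<close>

lemma antipode_equation_transpose:
  assumes x: "x \<in> X" and y: "y \<in> X" and p: "p \<in> X" and q: "q \<in> X"
    and P: "P \<in> lin_maps k (dhom C x y) (dhom C q p)" and Q: "Q \<in> lin_maps k (dhom C y x) (dhom C q p)"
    and u: "u \<in> lin_maps k (mor A p q) (mor A x y)" and v: "v \<in> lin_maps k (mor A p q) (mor A y x)"
    and Pv: "\<And>c a. c \<in> carrier (dhom C x y) \<Longrightarrow> a \<in> carrier (mor A p q) \<Longrightarrow> \<phi> q p (P c) a = \<phi> x y c (v a)"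
    and Qu: "\<And>c a. c \<in> carrier (dhom C y x) \<Longrightarrow> a \<in> carrier (mor A p q) \<Longrightarrow> \<phi> q p (Q c) a = \<phi> y x c (u a)"
  shows "(\<forall>c\<in>carrier (dhom C x x). mult_map k (dhom C q p)
        (tensor_map k (dhom C x y) (dhom C y x) (dhom C q p) (dhom C q p) P Q (cocomp C x y x c)) =
        unit_map (dhom C q p) (coident C x c)) \<longleftrightarrow>
    (\<forall>a\<in>carrier (mor A p q). comp_map A x y x
        (tensor_map k (mor A p q) (mor A p q) (mor A x y) (mor A y x) u v (comult (mor A p q) a)) =
        counit (mor A p q) a \<odot>\<^bsub>mor A x x\<^esub> ident A x)"
    (is "(\<forall>c\<in>_. ?l c = ?l' c) \<longleftrightarrow> (\<forall>a\<in>_. ?r a = ?r' a)")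
proof -
  interpret cring k by (rule cring)
  interpret E: module k "dhom C q p" by (rule module_dhom[OF q p])
  interpret Axx: module k "mor A x x" by (rule module_mor[OF x x])
  have one: "\<one>\<^bsub>dhom C q p\<^esub> \<in> carrier (dhom C q p)"
    using fgp_algebra_dhom[OF q p] by (simp add: fgp_algebra_def ring.ring_simprules)
  have ident: "ident A x \<in> carrier (mor A x x)"
    using A x by (simp add: coalgebra_category_def)
  have coident: "coident C x c = \<phi> x x c (ident A x)" if "c \<in> carrier (dhom C x x)" for c
    using iso x that by (simp add: dual_alg_cat_iso_def dual_category_def)
  have coident_closed: "coident C x c \<in> carrier k" if "c \<in> carrier (dhom C x x)" for c
    using lin_maps_closed[OF phi_apply_lin[OF x x that] ident] coident[OF that] by simp
  have counit_closed: "counit (mor A p q) a \<in> carrier k" if "a \<in> carrier (mor A p q)" for a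
    using lin_maps_closed[OF counit_lin[OF p q] that] by simp
  have l: "?l c \<in> carrier (dhom C q p)" if "c \<in> carrier (dhom C x x)" for c
    unfolding mult_map_def
    by (intro lin_maps_closed[OF tensor_lift_lin[OF E.module_axioms E.module_axioms E.module_axioms mult_dhom_bilinear[OF q p]]]
        lin_maps_closed[OF tensor_map_lin[OF module_dhom[OF x y] module_dhom[OF y x] E.module_axioms E.module_axioms P Q]]
        lin_maps_closed[OF cocomp_lin[OF x y x]] that)
  have l': "?l' c \<in> carrier (dhom C q p)" if "c \<in> carrier (dhom C x x)" for c
    using one coident_closed[OF that] by (simp add: unit_map_def)
  have r: "?r a \<in> carrier (mor A x x)" if "a \<in> carrier (mor A p q)" for a
    by (intro lin_maps_closed[OF comp_map_lin[OF x y x]]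
        lin_maps_closed[OF tensor_map_lin[OF module_mor[OF p q] module_mor[OF p q] module_mor[OF x y] module_mor[OF y x] u v]]
        lin_maps_closed[OF comult_lin[OF p q]] that)
  have r': "?r' a \<in> carrier (mor A x x)" if "a \<in> carrier (mor A p q)" for a
    using ident counit_closed[OF that] by simp
  have lr: "\<phi> q p (?l c) a = \<phi> x x c (?r a)"
    if "c \<in> carrier (dhom C x x)" "a \<in> carrier (mor A p q)" for c a
    by (rule convolution_transpose[OF x y p q P Q u v Pv Qu that])
  \<comment> \<open>Both scalars are the product of \<open>coident C x c\<close> and
    \<open>counit (mor A p q) a\<close>: the unit of the algebra pairs as the counit of
    \<open>A\<close>, and the counit of \<open>C\<close> is evaluation at the identity.\<close>
  have lr': "\<phi> q p (?l' c) a = \<phi> x x c (?r' a)"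
    if c: "c \<in> carrier (dhom C x x)" and a: "a \<in> carrier (mor A p q)" for c a
  proof -
    have "\<phi> q p (?l' c) a = coident C x c \<otimes>\<^bsub>k\<^esub> counit (mor A p q) a"
      unfolding unit_map_def
      using lin_maps_smult[OF phi_eval_lin[OF q p a] coident_closed[OF c] one] phi_one[OF q p a] by simp
    also have "\<dots> = \<phi> x x c (?r' a)"
      using lin_maps_smult[OF phi_apply_lin[OF x x c] counit_closed[OF a] ident] coident[OF c] coident_closed[OF c] counit_closed[OF a]
      by (simp add: m_comm)
    finally show ?thesis .
  qed
  show ?thesis
  proof (intro iffI ballI)
    fix a assume L: "\<forall>c\<in>carrier (dhom C x x). ?l c = ?l' c" and a: "a \<in> carrier (mor A p q)"
    show "?r a = ?r' a"
    proof (rule dual_algebra_separates[OF fg_projective_mor[OF x x] r[OF a] r'[OF a]])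
      fix d assume "d \<in> carrier (dual_algebra k (mor A x x))"
      then obtain c where c: "c \<in> carrier (dhom C x x)" "d = \<phi> x x c"
        using phi_bij[OF x x] by (auto simp: bij_betw_def)
      have "\<phi> x x c (?r a) = \<phi> q p (?l c) a"
        by (rule lr[OF c(1) a, symmetric])
      also have "\<dots> = \<phi> q p (?l' c) a"
        using L c(1) by simp
      also have "\<dots> = \<phi> x x c (?r' a)"
        by (rule lr'[OF c(1) a])
      finally show "d (?r a) = d (?r' a)"
        by (simp only: c(2))
    qed
  next
    fix c assume R: "\<forall>a\<in>carrier (mor A p q). ?r a = ?r' a" and c: "c \<in> carrier (dhom C x x)"
    show "?l c = ?l' c"
    proof (rule phi_inj[OF q p l[OF c] l'[OF c]])
      fix a assume a: "a \<in> carrier (mor A p q)"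
      show "\<phi> q p (?l c) a = \<phi> q p (?l' c) a"
        unfolding lr[OF c a] lr'[OF c a] using R a by simp
    qed
  qed
qed

text \<open>A relation, so that either map may be the given one and the other be chosen. It is the
  adjointness \<open>\<langle>\<sigma> c, a\<rangle> = \<langle>c, s a\<rangle>\<close>, bundled
  with linearity of both maps.\<close>

definition transposes :: "'x \<Rightarrow> 'x \<Rightarrow> ('a \<Rightarrow> 'a) \<Rightarrow> ('c \<Rightarrow> 'c) \<Rightarrow> bool"
  where "transposes x y s \<sigma> \<longleftrightarrow>
    s \<in> lin_maps k (mor A x y) (mor A y x) \<and> \<sigma> \<in> lin_maps k (dhom C x y) (dhom C y x) \<and>
    (\<forall>c\<in>carrier (dhom C x y). \<forall>a\<in>carrier (mor A x y). \<phi> y x (\<sigma> c) a = \<phi> x y c (s a))"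

text \<open>Composing the form of \<open>c\<close> with \<open>s\<close> gives a form on
  \<open>mor A x y\<close>, which the inverse of \<open>\<phi> y x\<close> carries back to
  \<open>C\<close>.\<close>

lemma ex_transpose_to_dual:
  assumes x: "x \<in> X" and y: "y \<in> X" and s: "s \<in> lin_maps k (mor A x y) (mor A y x)"
  shows "\<exists>\<sigma>. transposes x y s \<sigma>"
proof -
  define h where "h c = (\<lambda>a\<in>carrier (mor A x y). \<phi> x y c (s a))" for c
  have h: "h \<in> lin_maps k (dhom C x y) (dual_algebra k (mor A x y))"
  proof (rule lin_mapsI)
    show closed: "h c \<in> carrier (dual_algebra k (mor A x y))" if "c \<in> carrier (dhom C x y)" for c
      unfolding h_def
      by (rule dual_algebraI[OF module_mor[OF x y] lin_maps_compose[OF s phi_apply_lin[OF x y that]]])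
    note ev = phi_eval_lin[OF x y lin_maps_closed[OF s]]
    show "h (c \<oplus>\<^bsub>dhom C x y\<^esub> d) = h c \<oplus>\<^bsub>dual_algebra k (mor A x y)\<^esub> h d"
      if "c \<in> carrier (dhom C x y)" "d \<in> carrier (dhom C x y)" for c d
      unfolding dual_algebra_simps(3)
      by (auto simp: h_def lin_maps_add[OF ev that] intro!: restrict_ext)
    show "h (r \<odot>\<^bsub>dhom C x y\<^esub> c) = r \<odot>\<^bsub>dual_algebra k (mor A x y)\<^esub> h c"
      if "r \<in> carrier k" "c \<in> carrier (dhom C x y)" for r c
      unfolding dual_algebra_simps(4)
      by (auto simp: h_def lin_maps_smult[OF ev that] intro!: restrict_ext)
  qed
  let ?g = "inv_into (carrier (dhom C y x)) (\<phi> y x)"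
  have "\<phi> y x (?g (h c)) = h c" if "c \<in> carrier (dhom C x y)" for c
    using phi_bij[OF y x] lin_maps_closed[OF h that] by (auto simp: bij_betw_def intro: f_inv_into_f)
  then have "transposes x y s (\<lambda>c. ?g (h c))"
    unfolding transposes_def
    using s lin_maps_compose[OF h lin_maps_inv_into[OF module_dhom[OF y x] phi_lin[OF y x] phi_bij[OF y x]]]
    by (simp add: h_def)
  then show ?thesis
    by blast
qed

text \<open>Conjugating \<open>\<sigma>\<close> by \<phi> yields a linear map between dual modules,
  and reflexivity presents it as a transpose.\<close>

lemma ex_transpose_from_dual:
  assumes x: "x \<in> X" and y: "y \<in> X" and \<sigma>: "\<sigma> \<in> lin_maps k (dhom C x y) (dhom C y x)"
  shows "\<exists>s. transposes x y s \<sigma>"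
proof -
  let ?g = "inv_into (carrier (dhom C x y)) (\<phi> x y)"
  have g: "?g \<in> lin_maps k (dual_algebra k (mor A y x)) (dhom C x y)"
    by (rule lin_maps_inv_into[OF module_dhom[OF x y] phi_lin[OF x y] phi_bij[OF x y]])
  obtain s where s: "s \<in> lin_maps k (mor A x y) (mor A y x)"
    and eq: "\<And>d a. d \<in> carrier (dual_algebra k (mor A y x)) \<Longrightarrow> a \<in> carrier (mor A x y) \<Longrightarrow>
      d (s a) = \<phi> y x (\<sigma> (?g d)) a"
    using dual_map_transpose[OF module_mor[OF x y] fg_projective_mor[OF y x]
        lin_maps_compose[OF lin_maps_compose[OF g \<sigma>] phi_lin[OF y x]]] by blast
  have "\<phi> y x (\<sigma> c) a = \<phi> x y c (s a)" if "c \<in> carrier (dhom C x y)" "a \<in> carrier (mor A x y)" for c a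
    using eq[OF lin_maps_closed[OF phi_lin[OF x y] that(1)] that(2)] phi_bij[OF x y] that(1)
    by (simp add: bij_betw_def)
  then have "transposes x y s \<sigma>"
    using s \<sigma> by (simp add: transposes_def)
  then show ?thesis
    by blast
qed

text \<open>The transpose of \<open>S x y\<close> maps \<open>dhom C x y\<close> to
  \<open>dhom C y x\<close>, which makes it the component \<open>T y x\<close>. The equations match
  crosswise, the right one for \<open>C\<close> at (x, y) with the left one for \<open>A\<close> at
  (y, x), and the left one for \<open>C\<close> with the right one for \<open>A\<close> at the same
  pair. The equivalence is therefore between the statements quantified over all pairs.\<close>

lemma antipode_transpose:
  assumes "\<And>x y. x \<in> X \<Longrightarrow> y \<in> X \<Longrightarrow> transposes x y (S x y) (T y x)"
  shows "(\<forall>x\<in>X. \<forall>y\<in>X. \<forall>a\<in>carrier (mor A x y).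
           comp_map A x y x (tensor_map k (mor A x y) (mor A x y) (mor A x y) (mor A y x)
              id (S x y) (comult (mor A x y) a)) =
             counit (mor A x y) a \<odot>\<^bsub>mor A x x\<^esub> ident A x \<and>
           comp_map A y x y (tensor_map k (mor A x y) (mor A x y) (mor A y x) (mor A x y)
              (S x y) id (comult (mor A x y) a)) =
             counit (mor A x y) a \<odot>\<^bsub>mor A y y\<^esub> ident A y) \<longleftrightarrow>
        (\<forall>x\<in>X. \<forall>y\<in>X. \<forall>c\<in>carrier (dhom C x x).
           mult_map k (dhom C x y)
             (tensor_map k (dhom C x y) (dhom C y x) (dhom C x y) (dhom C x y)
                id (T x y) (cocomp C x y x c)) =
             unit_map (dhom C x y) (coident C x c) \<and>
           mult_map k (dhom C y x)
             (tensor_map k (dhom C x y) (dhom C y x) (dhom C y x) (dhom C y x)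
                (T y x) id (cocomp C x y x c)) =
             unit_map (dhom C y x) (coident C x c))"
proof -
  let ?h1 = "\<lambda>x y. \<forall>a\<in>carrier (mor A x y).
           comp_map A x y x (tensor_map k (mor A x y) (mor A x y) (mor A x y) (mor A y x)
              id (S x y) (comult (mor A x y) a)) =
             counit (mor A x y) a \<odot>\<^bsub>mor A x x\<^esub> ident A x"
  let ?h2 = "\<lambda>x y. \<forall>a\<in>carrier (mor A x y).
           comp_map A y x y (tensor_map k (mor A x y) (mor A x y) (mor A y x) (mor A x y)
              (S x y) id (comult (mor A x y) a)) =
             counit (mor A x y) a \<odot>\<^bsub>mor A y y\<^esub> ident A y"
  let ?d1 = "\<lambda>x y. \<forall>c\<in>carrier (dhom C x x).
           mult_map k (dhom C x y)
             (tensor_map k (dhom C x y) (dhom C y x) (dhom C x y) (dhom C x y)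
                id (T x y) (cocomp C x y x c)) =
             unit_map (dhom C x y) (coident C x c)"
  let ?d2 = "\<lambda>x y. \<forall>c\<in>carrier (dhom C x x).
           mult_map k (dhom C y x)
             (tensor_map k (dhom C x y) (dhom C y x) (dhom C y x) (dhom C y x)
                (T y x) id (cocomp C x y x c)) =
             unit_map (dhom C y x) (coident C x c)"
  have S: "S x y \<in> lin_maps k (mor A x y) (mor A y x)" and T: "T y x \<in> lin_maps k (dhom C x y) (dhom C y x)"
    and tr: "\<And>c a. c \<in> carrier (dhom C x y) \<Longrightarrow> a \<in> carrier (mor A x y) \<Longrightarrow>
      \<phi> y x (T y x c) a = \<phi> x y c (S x y a)"
    if "x \<in> X" "y \<in> X" for x y
    using assms[OF that] by (auto simp: transposes_def)
  \<comment> \<open>Here \<open>P\<close> and \<open>v\<close> are identities, which forces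
    \<open>p = y\<close> and \<open>q = x\<close>, and \<open>T x y\<close> is the transpose of
    \<open>S y x\<close>.\<close>
  have "?d1 x y \<longleftrightarrow> ?h2 y x" if "x \<in> X" "y \<in> X" for x y
    using antipode_equation_transpose[OF that that(2,1) lin_maps_id T[OF that(2,1)] S[OF that(2,1)] lin_maps_id]
      tr[OF that(2,1)] by simp
  \<comment> \<open>Here \<open>Q\<close> and \<open>u\<close> are identities, so that
    \<open>p = x\<close> and \<open>q = y\<close>, and \<open>T y x\<close> is the transpose of
    \<open>S x y\<close>.\<close>
  moreover have "?d2 x y \<longleftrightarrow> ?h1 x y" if "x \<in> X" "y \<in> X" for x y
    using antipode_equation_transpose[OF that that T[OF that] lin_maps_id lin_maps_id S[OF that]]
      tr[OF that] by simp
  ultimately have "(\<forall>x\<in>X. \<forall>y\<in>X. ?h1 x y \<and> ?h2 x y) \<longleftrightarrow> (\<forall>x\<in>X. \<forall>y\<in>X. ?d1 x y \<and> ?d2 x y)"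
    by (metis (no_types, lifting))
  then show ?thesis
    unfolding ball_conj_distrib .
qed

lemma hopf_category_iff_dual_hopf_category: "hopf_category k X A \<longleftrightarrow> dual_hopf_category k X C"
proof
  assume "hopf_category k X A"
  then obtain S where S: "\<forall>x\<in>X. \<forall>y\<in>X. S x y \<in> lin_maps k (mor A x y) (mor A y x)"
    and eq: "\<forall>x\<in>X. \<forall>y\<in>X. \<forall>a\<in>carrier (mor A x y).
           comp_map A x y x (tensor_map k (mor A x y) (mor A x y) (mor A x y) (mor A y x)
              id (S x y) (comult (mor A x y) a)) =
             counit (mor A x y) a \<odot>\<^bsub>mor A x x\<^esub> ident A x \<and>
           comp_map A y x y (tensor_map k (mor A x y) (mor A x y) (mor A y x) (mor A x y)
              (S x y) id (comult (mor A x y) a)) =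
             counit (mor A x y) a \<odot>\<^bsub>mor A y y\<^esub> ident A y"
    unfolding hopf_category_def by blast
  \<comment> \<open>The components are chosen independently for each pair of objects, with the
    indices reversed as transposition demands.\<close>
  define T where "T y x = (SOME \<sigma>. transposes x y (S x y) \<sigma>)" for x y
  have T: "transposes x y (S x y) (T y x)" if "x \<in> X" "y \<in> X" for x y
    unfolding T_def by (rule someI_ex[of "transposes x y (S x y)"], rule ex_transpose_to_dual[OF that]) (use S that in blast)
  show "dual_hopf_category k X C"
    unfolding dual_hopf_category_def
  proof (intro conjI C exI[of _ T])
    show "\<forall>x\<in>X. \<forall>y\<in>X. T x y \<in> lin_maps k (dhom C y x) (dhom C x y)"
      using T unfolding transposes_def by blast
  qed (rule iffD1[OF antipode_transpose[OF T] eq])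
next
  assume "dual_hopf_category k X C"
  then obtain T where T: "\<forall>x\<in>X. \<forall>y\<in>X. T x y \<in> lin_maps k (dhom C y x) (dhom C x y)"
    and eq: "\<forall>x\<in>X. \<forall>y\<in>X. \<forall>c\<in>carrier (dhom C x x).
           mult_map k (dhom C x y)
             (tensor_map k (dhom C x y) (dhom C y x) (dhom C x y) (dhom C x y)
                id (T x y) (cocomp C x y x c)) =
             unit_map (dhom C x y) (coident C x c) \<and>
           mult_map k (dhom C y x)
             (tensor_map k (dhom C x y) (dhom C y x) (dhom C y x) (dhom C y x)
                (T y x) id (cocomp C x y x c)) =
             unit_map (dhom C y x) (coident C x c)"
    unfolding dual_hopf_category_def by blast
  define S where "S x y = (SOME s. transposes x y s (T y x))" for x y
  have S: "transposes x y (S x y) (T y x)" if "x \<in> X" "y \<in> X" for x y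
    unfolding S_def by (rule someI_ex[of "\<lambda>s. transposes x y s (T y x)"], rule ex_transpose_from_dual[OF that]) (use T that in blast)
  show "hopf_category k X A"
    unfolding hopf_category_def
  proof (intro conjI A exI[of _ S])
    show "\<forall>x\<in>X. \<forall>y\<in>X. S x y \<in> lin_maps k (mor A x y) (mor A y x)"
      using S unfolding transposes_def by blast
  qed (rule iffD2[OF antipode_transpose[OF S] eq])
qed

end

theorem theorem4p6:
  fixes k :: "('k, 'r) ring_scheme" and X :: "'x set"
    and A :: "('k, 'x, 'a) coalg_cat" and C :: "('k, 'x, 'c) dual_alg_cat"
  assumes "cring k"
    and "coalgebra_category k X A"
    and "dual_algebra_category k X C"
    and "correspond k X A C"
  shows "hopf_category k X A \<longleftrightarrow> dual_hopf_category k X C"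
proof -
  obtain \<phi> where "dual_alg_cat_iso k X C (dual_category k A) \<phi>"
    using assms(4) unfolding correspond_def by blast
  then interpret category_duality k X A C \<phi>
    using assms(1-3) by (intro category_duality.intro)
  show ?thesis
    by (rule hopf_category_iff_dual_hopf_category)
qed

end
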